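(* The Zh-construction is functorial under virtual link cobordism. Namely, given a cobordism between virtual link diagrams $D$ and $D'$, there is a cobordism between the semi-welded link diagrams $\mathrm{Zh}(D)$ and $\mathrm{Zh}(D')$. Furthermore, if the cobordism from $D$ to $D'$ has $b$ births, $d$ deaths, and $s$ saddles, then the cobordism from $\mathrm{Zh}(D)$ to $\mathrm{Zh}(D')$ also has $b$ births, $d$ deaths, and $s$ saddles.
   Context: A virtual link diagram is an immersion of oriented circles in the plane whose double points are each either classical (with over/under information) or virtual. The generalized Reidemeister moves are planar isotopy, the classical Reidemeister moves, and the detour move (an arc passing only through virtual crossings may be replaced by any other arc with the same endpoints, with all its double points virtual). Up to detour moves, a diagram is the same as its Gauss diagram: oriented circles with one signed arrow per classical crossing, pointing from the overcrossing point (foot) to the undercrossing point (head). The forbidden overpass move moves an overcrossing arc across a virtual crossing; on Gauss diagrams it exchanges two adjacent arrow feet. Zh-construction: $\mathrm{Zh}(D)=D\cup\omega$ is obtained from $D$ by adding one new component $\omega$, having exactly two classical crossings for each classical crossing of $D$, at both of which $\omega$ is the overcrossing strand. On Gauss diagrams: for each arrow of $D$ of sign $\varepsilon$, add two arrows with feet on $\omega$, one with head just before the foot of the given arrow with sign $-\varepsilon$, and one with head just after the head of the given arrow with sign $\varepsilon$. (Equivalently, the heads may be placed just after the foot and just before the head, with the same signs.) The order of the arrow feet along $\omega$ is arbitrary. $\mathrm{Zh}(D)$ is considered up to semi-welded equivalence: generalized Reidemeister moves anywhere, and forbidden overpass moves only when the overcrossing arc belongs to the $\omega$-component. This class depends only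 on the virtual link of $D$. Cobordism: a birth (death) is the addition (removal) of a trivial unknotted unlinked component; a saddle cuts and rejoins two arcs respecting orientations. A cobordism between virtual link diagrams with the same number of components is a finite sequence of generalized Reidemeister moves, births, deaths and saddles transforming one into the other. A cobordism of semi-welded link diagrams is a finite sequence of semi-welded equivalence moves, births, deaths and saddles. *)

theory Defs
  imports Main "HOL-Combinatorics.Permutations"
begin

section \<open>Gauss diagrams\<close>

text \<open>
  Planar isotopy and the detour move do not change the Gauss diagram, and two virtual link
  diagrams with the same Gauss diagram differ by these moves only; hence a virtual link diagram
  is represented by its Gauss diagram.  An oriented circle is given by the word of the arrow ends
  met along it, read from an arbitrary base point; a circle without arrow ends is the empty word.
  Arrows carry labels from the type \<open>'a\<close>, and an arrow points from its foot (on the overcrossing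
  strand) to its head (on the undercrossing strand).  Independence of base points, of labels and
  of the numbering of the circles is part of the equivalence relations below.
\<close>

datatype 'a endpoint = Foot 'a | Head 'a

primrec arrow_of :: "'a endpoint \<Rightarrow> 'a" where
  "arrow_of (Foot a) = a"
| "arrow_of (Head a) = a"

text \<open>Only the values of \<open>arrow_sign\<close> on arrows of the diagram are meaningful.\<close>

record 'a gauss =
  circles :: "'a endpoint list list"
  arrow_sign :: "'a \<Rightarrow> int"

definition points :: "'a gauss \<Rightarrow> 'a endpoint set" where
  "points D = set (concat (circles D))"

definition arrows :: "'a gauss \<Rightarrow> 'a set" where
  "arrows D = arrow_of ` points D"

definition gauss_diagram :: "'a gauss \<Rightarrow> bool" where
  "gauss_diagram D \<longleftrightarrow>
     distinct (concat (circles D)) \<and>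
     (\<forall>a. Foot a \<in> points D \<longleftrightarrow> Head a \<in> points D) \<and>
     (\<forall>a\<in>arrows D. arrow_sign D a \<in> {1, -1})"

text \<open>\<open>next_to D p q\<close>: following the orientation, \<open>q\<close> comes immediately after \<open>p\<close> on some circle.\<close>

definition next_to :: "'a gauss \<Rightarrow> 'a endpoint \<Rightarrow> 'a endpoint \<Rightarrow> bool" where
  "next_to D p q \<longleftrightarrow>
     (\<exists>w\<in>set (circles D). \<exists>i<length w. w ! i = p \<and> w ! (Suc i mod length w) = q)"

definition adjacent :: "'a gauss \<Rightarrow> 'a endpoint \<Rightarrow> 'a endpoint \<Rightarrow> bool" where
  "adjacent D p q \<longleftrightarrow> next_to D p q \<or> next_to D q p"

definition adjacent_in_order ::
  "'a gauss \<Rightarrow> int \<Rightarrow> 'a endpoint \<Rightarrow> 'a endpoint \<Rightarrow> bool" where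
  "adjacent_in_order D \<delta> p q \<longleftrightarrow> (\<delta> = 1 \<and> next_to D p q) \<or> (\<delta> = -1 \<and> next_to D q p)"

definition remove_arrows :: "'a set \<Rightarrow> 'a gauss \<Rightarrow> 'a gauss" where
  "remove_arrows A D = D\<lparr>circles := map (filter (\<lambda>p. arrow_of p \<notin> A)) (circles D)\<rparr>"

definition move_points :: "('a endpoint \<Rightarrow> 'a endpoint) \<Rightarrow> 'a gauss \<Rightarrow> 'a gauss" where
  "move_points \<sigma> D = D\<lparr>circles := map (map \<sigma>) (circles D)\<rparr>"


section \<open>Moves\<close>

text \<open>
  The circle number \<open>i\<close> of \<open>D\<close> corresponds to the circle number \<open>\<pi> i\<close> of \<open>D'\<close>.
\<close>

definition same_diagram_via :: "(nat \<Rightarrow> nat) \<Rightarrow> 'a gauss \<Rightarrow> 'a gauss \<Rightarrow> bool" where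
  "same_diagram_via \<pi> D D' \<longleftrightarrow>
     length (circles D') = length (circles D) \<and>
     \<pi> permutes {..<length (circles D)} \<and>
     (\<exists>f. inj_on f (arrows D) \<and>
          (\<forall>a\<in>arrows D. arrow_sign D' (f a) = arrow_sign D a) \<and>
          (\<forall>i<length (circles D). \<exists>k.
             circles D' ! \<pi> i = rotate k (map (map_endpoint f) (circles D ! i))))"

definition R1_removal :: "'a gauss \<Rightarrow> 'a gauss \<Rightarrow> bool" where
  "R1_removal D D' \<longleftrightarrow> (\<exists>a. adjacent D (Foot a) (Head a) \<and> D' = remove_arrows {a} D)"

text \<open>
  The two crossings of a bigon have opposite signs; the strands may be oriented in the same or in
  opposite directions.
\<close>

definition R2_removal :: "'a gauss \<Rightarrow> 'a gauss \<Rightarrow> bool" where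
  "R2_removal D D' \<longleftrightarrow>
     (\<exists>a b. a \<noteq> b \<and> adjacent D (Foot a) (Foot b) \<and> adjacent D (Head a) (Head b) \<and>
            arrow_sign D a = - arrow_sign D b \<and> D' = remove_arrows {a, b} D)"

text \<open>
  The arrow \<open>x\<close> goes from the top to the middle strand, \<open>y\<close> from the top to the bottom strand, and
  \<open>z\<close> from the middle to the bottom strand; the numbers \<open>\<alpha>, \<beta>, \<gamma>\<close> record the order of the two
  crossings on the top, middle and bottom strand.  If the strands are straight, with direction
  vectors \<open>t, m, b\<close>, then the crossing signs are those of \<open>det(t,m)\<close>, \<open>det(t,b)\<close>, \<open>det(m,b)\<close>, and
  the triangle closes up as \<open>\<alpha> t + \<gamma> b = \<beta> m\<close> up to positive factors.  Taking determinants of this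
  equation with \<open>b\<close> and with \<open>t\<close> gives the two sign conditions, which single out exactly the
  oriented third Reidemeister moves.
\<close>

definition R3_move :: "'a gauss \<Rightarrow> 'a gauss \<Rightarrow> bool" where
  "R3_move D D' \<longleftrightarrow>
     (\<exists>x y z \<alpha> \<beta> \<gamma>. distinct [x, y, z] \<and>
        adjacent_in_order D \<alpha> (Foot x) (Foot y) \<and>
        adjacent_in_order D \<beta> (Head x) (Foot z) \<and>
        adjacent_in_order D \<gamma> (Head y) (Head z) \<and>
        \<alpha> * arrow_sign D y = \<beta> * arrow_sign D z \<and>
        \<gamma> * arrow_sign D y = \<beta> * arrow_sign D x \<and>
        D' = move_points
               (Transposition.transpose (Foot x) (Foot y) \<circ>
                Transposition.transpose (Head x) (Foot z) \<circ>
                Transposition.transpose (Head y) (Head z)) D)"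

definition reidemeister_move :: "'a gauss \<Rightarrow> 'a gauss \<Rightarrow> bool" where
  "reidemeister_move D D' \<longleftrightarrow>
     R1_removal D D' \<or> R1_removal D' D \<or> R2_removal D D' \<or> R2_removal D' D \<or> R3_move D D'"

definition virtual_move :: "'a gauss \<Rightarrow> 'a gauss \<Rightarrow> bool" where
  "virtual_move D D' \<longleftrightarrow> (\<exists>\<pi>. same_diagram_via \<pi> D D') \<or> reidemeister_move D D'"

text \<open>
  A semi-welded link diagram is a Gauss diagram with a distinguished circle \<open>\<omega>\<close>, by convention
  the first one (number 0).
\<close>

definition semiwelded_diagram :: "'a gauss \<Rightarrow> bool" where
  "semiwelded_diagram D \<longleftrightarrow> gauss_diagram D \<and> circles D \<noteq> []"

definition omega_overpass_move :: "'a gauss \<Rightarrow> 'a gauss \<Rightarrow> bool" where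
  "omega_overpass_move D D' \<longleftrightarrow>
     (\<exists>x y. x \<noteq> y \<and> Foot x \<in> set (hd (circles D)) \<and> Foot y \<in> set (hd (circles D)) \<and>
            adjacent D (Foot x) (Foot y) \<and>
            D' = move_points (Transposition.transpose (Foot x) (Foot y)) D)"

definition semiwelded_move :: "'a gauss \<Rightarrow> 'a gauss \<Rightarrow> bool" where
  "semiwelded_move D D' \<longleftrightarrow>
     (\<exists>\<pi>. \<pi> 0 = 0 \<and> same_diagram_via \<pi> D D') \<or> reidemeister_move D D' \<or>
     omega_overpass_move D D'"


section \<open>Cobordisms\<close>

definition birth :: "'a gauss \<Rightarrow> 'a gauss \<Rightarrow> bool" where
  "birth D D' \<longleftrightarrow> D' = D\<lparr>circles := circles D @ [[]]\<rparr>"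

text \<open>
  Splitting the circle number \<open>i\<close>.  Since base points may be moved, \<open>u @ v\<close> cuts it at two
  arbitrary places; the converse relation joins two circles.
\<close>

definition saddle_split :: "nat \<Rightarrow> 'a gauss \<Rightarrow> 'a gauss \<Rightarrow> bool" where
  "saddle_split i D D' \<longleftrightarrow>
     i < length (circles D) \<and>
     (\<exists>u v. circles D ! i = u @ v \<and> D' = D\<lparr>circles := (circles D)[i := u] @ [v]\<rparr>)"

definition virtual_saddle :: "'a gauss \<Rightarrow> 'a gauss \<Rightarrow> bool" where
  "virtual_saddle D D' \<longleftrightarrow> (\<exists>i. saddle_split i D D' \<or> saddle_split i D' D)"

text \<open>
  In a cobordism of semi-welded diagrams \<open>\<omega>\<close> remains the distinguished component throughout, so
  saddles involve the other components only.
\<close>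

definition semiwelded_saddle :: "'a gauss \<Rightarrow> 'a gauss \<Rightarrow> bool" where
  "semiwelded_saddle D D' \<longleftrightarrow> (\<exists>i. i \<noteq> 0 \<and> (saddle_split i D D' \<or> saddle_split i D' D))"

text \<open>
  \<open>cobordism_sequence diag eqv sad D D' b d s\<close>: a finite sequence of diagrams satisfying \<open>diag\<close>,
  from \<open>D\<close> to \<open>D'\<close>, whose steps are moves \<open>eqv\<close>, \<open>b\<close> births, \<open>d\<close> deaths and \<open>s\<close> saddles \<open>sad\<close>.
\<close>

inductive cobordism_sequence ::
  "('a gauss \<Rightarrow> bool) \<Rightarrow> ('a gauss \<Rightarrow> 'a gauss \<Rightarrow> bool) \<Rightarrow> ('a gauss \<Rightarrow> 'a gauss \<Rightarrow> bool) \<Rightarrow>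
   'a gauss \<Rightarrow> 'a gauss \<Rightarrow> nat \<Rightarrow> nat \<Rightarrow> nat \<Rightarrow> bool"
  for diag eqv sad D
where
  start: "diag D \<Longrightarrow> cobordism_sequence diag eqv sad D D 0 0 0"
| eqv_step: "cobordism_sequence diag eqv sad D E b d s \<Longrightarrow> eqv E F \<Longrightarrow> diag F \<Longrightarrow>
    cobordism_sequence diag eqv sad D F b d s"
| birth_step: "cobordism_sequence diag eqv sad D E b d s \<Longrightarrow> birth E F \<Longrightarrow> diag F \<Longrightarrow>
    cobordism_sequence diag eqv sad D F (Suc b) d s"
| death_step: "cobordism_sequence diag eqv sad D E b d s \<Longrightarrow> birth F E \<Longrightarrow> diag F \<Longrightarrow>
    cobordism_sequence diag eqv sad D F b (Suc d) s"
| saddle_step: "cobordism_sequence diag eqv sad D E b d s \<Longrightarrow> sad E F \<Longrightarrow> diag F \<Longrightarrow>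
    cobordism_sequence diag eqv sad D F b d (Suc s)"

definition virtual_cobordism :: "'a gauss \<Rightarrow> 'a gauss \<Rightarrow> nat \<Rightarrow> nat \<Rightarrow> nat \<Rightarrow> bool" where
  "virtual_cobordism D D' b d s \<longleftrightarrow>
     length (circles D) = length (circles D') \<and>
     cobordism_sequence gauss_diagram virtual_move virtual_saddle D D' b d s"

definition semiwelded_cobordism :: "'a gauss \<Rightarrow> 'a gauss \<Rightarrow> nat \<Rightarrow> nat \<Rightarrow> nat \<Rightarrow> bool" where
  "semiwelded_cobordism D D' b d s \<longleftrightarrow>
     cobordism_sequence semiwelded_diagram semiwelded_move semiwelded_saddle D D' b d s"


section \<open>The Zh-construction\<close>

text \<open>
  Labels of the arrows of \<open>Zh(D)\<close>: the arrows of \<open>D\<close>, and for each of them the two new arrows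
  with foot on \<open>\<omega>\<close>, one with head just before its foot and one with head just after its head.
\<close>

datatype 'a zh_arrow = Given 'a | AtFoot 'a | AtHead 'a

primrec zh_endpoint :: "'a endpoint \<Rightarrow> 'a zh_arrow endpoint list" where
  "zh_endpoint (Foot a) = [Head (AtFoot a), Foot (Given a)]"
| "zh_endpoint (Head a) = [Head (Given a), Head (AtHead a)]"

primrec zh_sign :: "('a \<Rightarrow> int) \<Rightarrow> 'a zh_arrow \<Rightarrow> int" where
  "zh_sign \<epsilon> (Given a) = \<epsilon> a"
| "zh_sign \<epsilon> (AtFoot a) = - \<epsilon> a"
| "zh_sign \<epsilon> (AtHead a) = \<epsilon> a"

text \<open>The diagram with the arrow feet on \<open>\<omega>\<close> ordered as in the list \<open>w\<close>.\<close>

definition zh_with :: "'a zh_arrow endpoint list \<Rightarrow> 'a gauss \<Rightarrow> 'a zh_arrow gauss" where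
  "zh_with w D =
     \<lparr>circles = w # map (\<lambda>c. concat (map zh_endpoint c)) (circles D),
      arrow_sign = zh_sign (arrow_sign D)\<rparr>"

text \<open>The set of all representatives, for all orders of the arrow feet along \<open>\<omega>\<close>.\<close>

definition Zh :: "'a gauss \<Rightarrow> 'a zh_arrow gauss set" where
  "Zh D = {zh_with w D | w. distinct w \<and>
             set w = Foot ` (AtFoot ` arrows D \<union> AtHead ` arrows D)}"

lemma Zh_nonempty: "Zh D \<noteq> {}"
proof -
  have "finite (Foot ` (AtFoot ` arrows D \<union> AtHead ` arrows D))"
    by (simp add: arrows_def points_def)
  then obtain w where "set w = Foot ` (AtFoot ` arrows D \<union> AtHead ` arrows D)" "distinct w"
    using finite_distinct_list by metis
  then show ?thesis
    unfolding Zh_def by blast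
qed

lemma in_zh_endpoint:
  "Foot (Given a) \<in> set (zh_endpoint p) \<longleftrightarrow> p = Foot a"
  "Head (Given a) \<in> set (zh_endpoint p) \<longleftrightarrow> p = Head a"
  "Head (AtFoot a) \<in> set (zh_endpoint p) \<longleftrightarrow> p = Foot a"
  "Head (AtHead a) \<in> set (zh_endpoint p) \<longleftrightarrow> p = Head a"
  "Foot (AtFoot a) \<notin> set (zh_endpoint p)"
  "Foot (AtHead a) \<notin> set (zh_endpoint p)"
  by (cases p; auto)+

lemma distinct_zh_endpoints: "distinct c \<Longrightarrow> distinct (concat (map zh_endpoint c))"
proof (induction c)
  case (Cons p c)
  have "set (zh_endpoint p) \<inter> set (zh_endpoint q) = {}" if "q \<in> set c" for q
  proof -
    have "p \<noteq> q"
      using that Cons.prems by auto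
    then show ?thesis
      by (cases p; cases q) auto
  qed
  moreover have "distinct (zh_endpoint p)"
    by (cases p) auto
  ultimately show ?case
    using Cons by auto
qed simp

lemma Zh_semiwelded_diagram:
  assumes D: "gauss_diagram D" and Z: "Z \<in> Zh D"
  shows "semiwelded_diagram Z"
proof -
  obtain w where w: "Z = zh_with w D" "distinct w"
      "set w = Foot ` (AtFoot ` arrows D \<union> AtHead ` arrows D)"
    using Z unfolding Zh_def by blast
  have conc: "concat (circles Z) = w @ concat (map zh_endpoint (concat (circles D)))"
  proof -
    have "concat (map (\<lambda>c. concat (map zh_endpoint c)) cs) = concat (map zh_endpoint (concat cs))"
      for cs :: "'a endpoint list list"
      by (induction cs) auto
    then show ?thesis
      by (simp add: w(1) zh_with_def)
  qed
  have arr: "a \<in> arrows D \<longleftrightarrow> Foot a \<in> points D" "a \<in> arrows D \<longleftrightarrow> Head a \<in> points D" for a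
  proof -
    have "Foot a \<in> points D \<longleftrightarrow> Head a \<in> points D"
      using D by (simp add: gauss_diagram_def)
    moreover have "a \<in> arrows D \<longleftrightarrow> Foot a \<in> points D \<or> Head a \<in> points D"
      unfolding arrows_def image_iff by (metis arrow_of.simps endpoint.exhaust)
    ultimately show "a \<in> arrows D \<longleftrightarrow> Foot a \<in> points D" "a \<in> arrows D \<longleftrightarrow> Head a \<in> points D"
      by auto
  qed
  have pts: "p \<in> points Z \<longleftrightarrow> p \<in> set w \<or> (\<exists>q\<in>points D. p \<in> set (zh_endpoint q))" for p
    unfolding points_def conc by auto
  have ends: "Foot (Given a) \<in> points Z \<longleftrightarrow> a \<in> arrows D"
    "Head (Given a) \<in> points Z \<longleftrightarrow> a \<in> arrows D"
    "Foot (AtFoot a) \<in> points Z \<longleftrightarrow> a \<in> arrows D"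
    "Head (AtFoot a) \<in> points Z \<longleftrightarrow> a \<in> arrows D"
    "Foot (AtHead a) \<in> points Z \<longleftrightarrow> a \<in> arrows D"
    "Head (AtHead a) \<in> points Z \<longleftrightarrow> a \<in> arrows D" for a
    unfolding pts w(3) using arr[of a] by (auto simp: in_zh_endpoint)
  have dist: "distinct (concat (circles Z))"
  proof -
    have "set w \<inter> set (concat (map zh_endpoint (concat (circles D)))) = {}"
      unfolding w(3) by (auto simp: in_zh_endpoint)
    then show ?thesis
      using D w(2) distinct_zh_endpoints unfolding conc gauss_diagram_def by auto
  qed
  have foot_head: "Foot a \<in> points Z \<longleftrightarrow> Head a \<in> points Z" for a
    by (cases a) (simp_all add: ends)
  have signs: "arrow_sign Z a \<in> {1, -1}" if "a \<in> arrows Z" for a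
  proof -
    have "Foot a \<in> points Z \<or> Head a \<in> points Z"
      using that unfolding arrows_def image_iff by (metis arrow_of.simps endpoint.exhaust)
    moreover have "arrow_sign D a' \<in> {1, -1}" if "a' \<in> arrows D" for a'
      using D that by (simp add: gauss_diagram_def)
    moreover have "arrow_sign Z = zh_sign (arrow_sign D)"
      by (simp add: w(1) zh_with_def)
    ultimately show ?thesis
      by (cases a) (fastforce simp: ends)+
  qed
  have "circles Z \<noteq> []"
    by (simp add: w(1) zh_with_def)
  then show ?thesis
    unfolding semiwelded_diagram_def gauss_diagram_def using dist foot_head signs by blast
qed

end

theory Submission
  imports Defs "HOL-Library.Nat_Bijection"
begin

text \<open>
  Call an arrow with foot on \<open>\<omega>\<close> a mark at its head. Since the feet on \<open>\<omega>\<close> may be reordered freely, two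
  marks of opposite sign that are adjacent on a strand cancel by a second Reidemeister move, so that
  up to semi-welded equivalence only the sum of the signs of the marks on each edge of the
  underlying Gauss diagram matters. A third Reidemeister move with \<open>\<omega>\<close> on top pushes marks of the
  same sign through both ends of an arrow. Given a Reidemeister move on \<open>D\<close>, pushing marks through
  its arrows clears the edges involved (up to a cancelling pair beside a bigon with parallel
  strands), the move is performed, and pushing marks back yields \<open>Zh\<close> of the new diagram. Births,
  deaths and saddles of \<open>D\<close> are births, deaths and saddles of \<open>Zh(D)\<close>.
\<close>

section \<open>Rotations and adjacency\<close>

text \<open>Pushing an integer \<open>k\<close> through an arrow subtracts \<open>k\<close> from
  both slots before its ends and adds \<open>k\<close> to both slots after them, so clearing the
  edges of a move is a linear system with one unknown per arrow. The third move behind a push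
  demands a definite order of two feet on \<omega>, which depends on the signs; free reordering
  supplies it, so every arrow admits every \<open>k\<close>, of either sign. The one obstruction is
  the bigon with parallel strands. Its inner edges can be cleared, but the outer slots of its four
  ends cannot all become empty. The leftover marks sit in slots that vanish together with the bigon,
  and a circle whose ends all vanish has no other slot to receive them. Hence these marks are
  cancelled in the same step that removes the bigon. The intermediate diagrams may carry arbitrarily
  many marks, which calls for an unlimited supply of labels; over \<open>nat\<close> a pairing
  function provides it. Births and saddles keep the order of the feet on \<omega>, whereas moves may
  change it. The induction along a cobordism therefore treats all representatives of
  \<open>Zh\<close> at once.\<close>

lemma rotate_concat_map:
  "\<exists>k'. concat (map g (rotate k c)) = rotate k' (concat (map g c))"
proof -
  define m where "m = k mod length c"
  have "concat (map g c) = concat (map g (take m c)) @ concat (map g (drop m c))"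
    by (simp flip: concat_append map_append)
  then have "rotate (length (concat (map g (take m c)))) (concat (map g c)) =
      concat (map g (drop m c)) @ concat (map g (take m c))"
    by (simp only: rotate_append)
  also have "\<dots> = concat (map g (rotate k c))"
    by (simp add: rotate_drop_take m_def)
  finally show ?thesis by metis
qed

text \<open>A filter replaces every letter by a word of length at most one, so this is an instance
  of the previous lemma.\<close>

lemma rotate_filter: "\<exists>k'. filter P (rotate k c) = rotate k' (filter P c)"
proof -
  have "filter P xs = concat (map (\<lambda>x. if P x then [x] else []) xs)" for xs
    by (induction xs) auto
  then show ?thesis by (simp only: rotate_concat_map)
qed

lemma rotate_sym:
  assumes "ys = rotate k xs"
  shows "\<exists>k'. xs = rotate k' ys"
proof -
  have "rotate (length xs - k mod length xs) ys = xs"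
  proof (cases "xs = []")
    case False
    then have "length xs - k mod length xs + k mod length xs = length xs" by simp
    then show ?thesis
      unfolding assms rotate_conv_mod[of k] rotate_rotate by simp
  qed (simp add: assms)
  then show ?thesis by metis
qed

text \<open>Moving the base point to \<open>p\<close> turns cyclic adjacency into a word that begins
  with \<open>p\<close>, \<open>q\<close>. The hypothesis \<open>p \<noteq> q\<close> excludes the
  word with one letter, whose only end is next to itself.\<close>

lemma next_toE:
  assumes "next_to D p q" "p \<noteq> q"
  obtains i k r where "i < length (circles D)" "rotate k (circles D ! i) = p # q # r"
proof -
  obtain i j where i: "i < length (circles D)" and j: "j < length (circles D ! i)"
      and pq: "circles D ! i ! j = p" "circles D ! i ! (Suc j mod length (circles D ! i)) = q"
    using assms(1) unfolding next_to_def by (metis in_set_conv_nth)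
  define w where "w = circles D ! i"
  have len: "1 < length w"
    using j pq assms(2) unfolding w_def[symmetric]
    by (metis less_one linorder_neqE_nat mod_less_divisor not_less_zero)
  have "w \<noteq> []" using len by auto
  then have "rotate j w ! 0 = p" "rotate j w ! 1 = q"
    using nth_rotate[of 0 w j] nth_rotate[of 1 w j] j pq len by (simp_all flip: w_def)
  moreover have "1 < length (rotate j w)" using len by simp
  ultimately obtain r where "rotate j w = p # q # r"
    by (cases "rotate j w"; cases "tl (rotate j w)") auto
  then show thesis using i that unfolding w_def by blast
qed

lemma next_toI:
  assumes "w \<in> set (circles D)" "rotate k w = p # q # r"
  shows "next_to D p q"
proof -
  have len: "length w = Suc (Suc (length r))" using assms(2) by (metis length_Cons length_rotate)
  have "rotate k w ! 0 = p" "rotate k w ! 1 = q" using assms(2) by simp_all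
  then have "w ! (k mod length w) = p" "w ! (Suc (k mod length w) mod length w) = q"
    using len by (auto simp: nth_rotate mod_Suc_eq)
  moreover have "k mod length w < length w" using len by simp
  ultimately show ?thesis unfolding next_to_def using assms(1) by blast
qed

lemma next_to_middle:
  assumes "u @ p # q # v \<in> set (circles D)"
  shows "next_to D p q"
  using next_toI[OF assms, of "length u"] by (simp add: rotate_append)

lemma next_to_map_circles:
  assumes "next_to D p q" "circles D' = map (map f) (circles D)"
  shows "next_to D' (f p) (f q)"
proof -
  obtain w i where wi: "w \<in> set (circles D)" "i < length w" "w ! i = p"
      "w ! (Suc i mod length w) = q"
    using assms(1) unfolding next_to_def by blast
  moreover have "Suc i mod length w < length w"
    using wi(2) by (metis mod_less_divisor gr_zeroI not_less_zero)
  ultimately show ?thesis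
    unfolding next_to_def using assms(2) by (intro bexI[of _ "map f w"] exI[of _ i]) auto
qed



section \<open>Semi-welded equivalence\<close>

lemma same_diagram_arrows:
  fixes D D' :: "'a gauss"
  assumes len: "length (circles D') = length (circles D)"
    and \<pi>: "\<pi> permutes {..<length (circles D)}"
    and c: "\<And>i. i < length (circles D) \<Longrightarrow>
      \<exists>k. circles D' ! \<pi> i = rotate k (map (map_endpoint f) (circles D ! i))"
  shows "arrows D' = f ` arrows D"
proof -
  let ?n = "length (circles D)"
  have pts: "points E = (\<Union>i<length (circles E). set (circles E ! i))" for E :: "'a gauss"
  proof -
    have "set (circles E) = (!) (circles E) ` {..<length (circles E)}"
      by (auto simp: set_conv_nth)
    then show ?thesis by (simp add: points_def)
  qed
  have "points D' = (\<Union>i\<in>\<pi> ` {..<?n}. set (circles D' ! i))"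
    by (simp only: pts len permutes_image[OF \<pi>])
  also have "\<dots> = (\<Union>i<?n. set (circles D' ! \<pi> i))" by simp
  also have "\<dots> = (\<Union>i<?n. map_endpoint f ` set (circles D ! i))"
    using c by (intro SUP_cong refl) (metis lessThan_iff list.set_map set_rotate)
  also have "\<dots> = map_endpoint f ` points D" unfolding pts by blast
  finally have "points D' = map_endpoint f ` points D" .
  moreover have "arrow_of (map_endpoint f p) = f (arrow_of p)" for p by (cases p) auto
  ultimately show ?thesis unfolding arrows_def by (simp add: image_image)
qed

lemma same_diagram_via_sym:
  assumes "same_diagram_via \<pi> D D'"
  shows "same_diagram_via (inv \<pi>) D' D"
proof -
  let ?n = "length (circles D)"
  obtain f where len: "length (circles D') = ?n" and \<pi>: "\<pi> permutes {..<?n}"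
    and f: "inj_on f (arrows D)" "\<forall>a\<in>arrows D. arrow_sign D' (f a) = arrow_sign D a"
    and c: "\<And>i. i < ?n \<Longrightarrow> \<exists>k. circles D' ! \<pi> i = rotate k (map (map_endpoint f) (circles D ! i))"
    using assms unfolding same_diagram_via_def by blast
  \<comment> \<open>The relabelling is injective only on the arrows of \<open>D\<close>, so it is
    inverted there.\<close>
  define g where "g = inv_into (arrows D) f"
  have gf: "g (f a) = a" if "a \<in> arrows D" for a
    using that f(1) by (simp add: g_def)
  have arr: "arrows D' = f ` arrows D" using same_diagram_arrows[OF len \<pi> c] .
  have "inj_on g (arrows D')" unfolding arr by (intro inj_onI) (auto simp: gf)
  moreover have "\<forall>a\<in>arrows D'. arrow_sign D (g a) = arrow_sign D' a"
    using f(2) by (auto simp: arr gf)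
  moreover have "\<exists>k. circles D ! inv \<pi> j = rotate k (map (map_endpoint g) (circles D' ! j))"
    if "j < length (circles D')" for j
  proof -
    define i where "i = inv \<pi> j"
    have i: "i < ?n" "\<pi> i = j"
      using that \<pi> len permutes_inverses(1)[OF \<pi>] permutes_in_image[OF permutes_inv[OF \<pi>]]
      by (auto simp: i_def)
    obtain k where "circles D' ! j = rotate k (map (map_endpoint f) (circles D ! i))"
      using c i by blast
    moreover have "map (map_endpoint g) (map (map_endpoint f) (circles D ! i)) = circles D ! i"
    proof -
      have "map_endpoint g (map_endpoint f p) = p" if "p \<in> set (circles D ! i)" for p
      proof -
        have "p \<in> points D" using that i(1) by (auto simp: points_def)
        then have "arrow_of p \<in> arrows D" by (simp add: arrows_def)
        then show ?thesis by (cases p) (auto simp: gf)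
      qed
      then show ?thesis by (simp add: map_idI)
    qed
    ultimately have "map (map_endpoint g) (circles D' ! j) = rotate k (circles D ! i)"
      by (metis rotate_map)
    then show ?thesis unfolding i_def[symmetric] by (rule rotate_sym)
  qed
  ultimately show ?thesis
    unfolding same_diagram_via_def using len permutes_inv[OF \<pi>] by auto
qed

lemma move_points_involution:
  assumes "\<And>p. \<sigma> (\<sigma> p) = p" "D' = move_points \<sigma> D"
  shows "D = move_points \<sigma> D'"
proof -
  have "\<sigma> \<circ> \<sigma> = id" using assms(1) by auto
  then show ?thesis unfolding assms(2) move_points_def by simp
qed

lemma adjacent_in_order_map_circles:
  assumes "adjacent_in_order D \<delta> p q" "circles D' = map (map f) (circles D)"
  shows "adjacent_in_order D' (- \<delta>) (f q) (f p)"
  using assms next_to_map_circles[OF _ assms(2)] unfolding adjacent_in_order_def by auto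

text \<open>The six ends are distinct, so the three transpositions have disjoint supports and their
  composite is an involution. On the middle strand a head changes places with a foot.\<close>

lemma triple_transpose:
  fixes x y z :: 'a
  assumes "distinct [x, y, z]"
  defines "\<sigma> \<equiv> Transposition.transpose (Foot x) (Foot y) \<circ>
                Transposition.transpose (Head x) (Foot z) \<circ>
                Transposition.transpose (Head y) (Head z)"
  shows "\<sigma> (Foot x) = Foot y" "\<sigma> (Foot y) = Foot x" "\<sigma> (Head x) = Foot z"
    "\<sigma> (Foot z) = Head x" "\<sigma> (Head y) = Head z" "\<sigma> (Head z) = Head y"
    "p \<notin> {Foot x, Foot y, Head x, Foot z, Head y, Head z} \<Longrightarrow> \<sigma> p = p"
    "\<sigma> (\<sigma> p) = p"
proof -
  show 1: "\<sigma> (Foot x) = Foot y" "\<sigma> (Foot y) = Foot x" "\<sigma> (Head x) = Foot z"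
    "\<sigma> (Foot z) = Head x" "\<sigma> (Head y) = Head z" "\<sigma> (Head z) = Head y"
    using assms(1) by (auto simp: \<sigma>_def transpose_def)
  show 2: "\<sigma> p = p" if "p \<notin> {Foot x, Foot y, Head x, Foot z, Head y, Head z}" for p
    using that by (auto simp: \<sigma>_def transpose_def)
  show "\<sigma> (\<sigma> p) = p"
    using 1 2[of p] by (cases "p \<in> {Foot x, Foot y, Head x, Foot z, Head y, Head z}") auto
qed

text \<open>The same arrows witness the inverse move: exchanging neighbours reverses the order on
  each strand, and the sign conditions survive negating \<alpha>, \<beta>, \<gamma>
  simultaneously.\<close>

lemma R3_move_sym:
  assumes "R3_move D D'"
  shows "R3_move D' D"
proof -
  obtain x y z \<alpha> \<beta> \<gamma> where xyz: "distinct [x, y, z]"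
    and adj: "adjacent_in_order D \<alpha> (Foot x) (Foot y)"
        "adjacent_in_order D \<beta> (Head x) (Foot z)"
        "adjacent_in_order D \<gamma> (Head y) (Head z)"
    and s: "\<alpha> * arrow_sign D y = \<beta> * arrow_sign D z" "\<gamma> * arrow_sign D y = \<beta> * arrow_sign D x"
    and D': "D' = move_points
               (Transposition.transpose (Foot x) (Foot y) \<circ>
                Transposition.transpose (Head x) (Foot z) \<circ>
                Transposition.transpose (Head y) (Head z)) D"
    using assms unfolding R3_move_def by blast
  let ?\<sigma> = "Transposition.transpose (Foot x) (Foot y) \<circ>
                Transposition.transpose (Head x) (Foot z) \<circ>
                Transposition.transpose (Head y) (Head z)"
  note t = triple_transpose[OF xyz]
  have c: "circles D' = map (map ?\<sigma>) (circles D)" by (simp add: D' move_points_def)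
  have "D = move_points ?\<sigma> D'"
    using move_points_involution[OF t(8) D'] .
  moreover have "arrow_sign D' = arrow_sign D" by (simp add: D' move_points_def)
  moreover have "adjacent_in_order D' (- \<alpha>) (Foot x) (Foot y)"
    using adjacent_in_order_map_circles[OF adj(1) c] unfolding t(1,2) .
  moreover have "adjacent_in_order D' (- \<beta>) (Head x) (Foot z)"
    using adjacent_in_order_map_circles[OF adj(2) c] unfolding t(3,4) .
  moreover have "adjacent_in_order D' (- \<gamma>) (Head y) (Head z)"
    using adjacent_in_order_map_circles[OF adj(3) c] unfolding t(5,6) .
  ultimately show ?thesis
    unfolding R3_move_def using xyz s
    by (intro exI[of _ x] exI[of _ y] exI[of _ z] exI[of _ "- \<alpha>"] exI[of _ "- \<beta>"]
        exI[of _ "- \<gamma>"]) simp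
qed

lemma omega_overpass_move_sym:
  assumes "circles D \<noteq> []" "omega_overpass_move D D'"
  shows "omega_overpass_move D' D"
proof -
  obtain x y where xy: "x \<noteq> y" "Foot x \<in> set (hd (circles D))" "Foot y \<in> set (hd (circles D))"
      "adjacent D (Foot x) (Foot y)"
      and D': "D' = move_points (Transposition.transpose (Foot x) (Foot y)) D"
    using assms unfolding omega_overpass_move_def by blast
  let ?\<tau> = "Transposition.transpose (Foot x) (Foot y)"
  have "D = move_points ?\<tau> D'"
    using move_points_involution[OF _ D'] by simp
  moreover have c: "circles D' = map (map ?\<tau>) (circles D)" by (simp add: D' move_points_def)
  have "?\<tau> (Foot y) = Foot x" "?\<tau> (Foot x) = Foot y" by simp_all
  then have "adjacent D' (Foot x) (Foot y)"
    using xy(4) next_to_map_circles[OF _ c] unfolding adjacent_def by metis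
  moreover have "Foot x \<in> set (hd (circles D'))" "Foot y \<in> set (hd (circles D'))"
    using xy(2,3) assms(1) image_eqI[of "Foot x" ?\<tau> "Foot y"] image_eqI[of "Foot y" ?\<tau> "Foot x"]
    by (auto simp: c hd_map)
  ultimately show ?thesis unfolding omega_overpass_move_def using xy(1) by blast
qed

text \<open>The moves are relations on arbitrary records; asking both ends to be diagrams makes
  every chain of steps usable inside a cobordism sequence, where each term must be a
  diagram.\<close>

definition semiwelded_step :: "'a gauss \<Rightarrow> 'a gauss \<Rightarrow> bool" where
  "semiwelded_step Z Z' \<longleftrightarrow> semiwelded_diagram Z \<and> semiwelded_diagram Z' \<and> semiwelded_move Z Z'"

abbreviation semiwelded_equiv :: "'a gauss \<Rightarrow> 'a gauss \<Rightarrow> bool" (infix "\<approx>" 50) where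
  "Z \<approx> Z' \<equiv> semiwelded_step\<^sup>*\<^sup>* Z Z'"

text \<open>The first two Reidemeister moves are listed in both directions, the third and the
  overpass move undo themselves, and the inverse of a renumbering that fixes 0 fixes 0.\<close>

lemma semiwelded_step_sym:
  assumes "semiwelded_step Z Z'"
  shows "semiwelded_step Z' Z"
proof -
  have Z: "semiwelded_diagram Z" "semiwelded_diagram Z'" "semiwelded_move Z Z'"
    using assms by (auto simp: semiwelded_step_def)
  have "\<exists>\<rho>. \<rho> 0 = 0 \<and> same_diagram_via \<rho> Z' Z" if "\<pi> 0 = 0" "same_diagram_via \<pi> Z Z'" for \<pi>
  proof -
    have "inj \<pi>" using that(2) by (meson same_diagram_via_def permutes_inj)
    then have "inv \<pi> 0 = 0" using that(1) by (metis inv_f_f)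
    then show ?thesis using same_diagram_via_sym[OF that(2)] by blast
  qed
  moreover have "circles Z \<noteq> []" using Z(1) by (simp add: semiwelded_diagram_def)
  ultimately have "semiwelded_move Z' Z"
    using Z(3) R3_move_sym omega_overpass_move_sym[of Z Z']
    unfolding semiwelded_move_def reidemeister_move_def by blast
  then show ?thesis using Z by (simp add: semiwelded_step_def)
qed

lemma semiwelded_equiv_sym: "Z \<approx> Z' \<Longrightarrow> Z' \<approx> Z"
proof (induction rule: rtranclp_induct)
  case (step Y X)
  then show ?case
    by (meson semiwelded_step_sym converse_rtranclp_into_rtranclp)
qed simp

lemma semiwelded_equiv_step:
  assumes "semiwelded_diagram Z" "semiwelded_diagram Z'" "semiwelded_move Z Z'"
  shows "Z \<approx> Z'"
  using assms by (simp add: semiwelded_step_def r_into_rtranclp)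

text \<open>Equivalences prolong a sequence without affecting the three counts.\<close>

lemma cobordism_sequence_equiv:
  assumes "Z' \<approx> Z''"
    and "cobordism_sequence semiwelded_diagram semiwelded_move sad Z Z' b d s"
  shows "cobordism_sequence semiwelded_diagram semiwelded_move sad Z Z'' b d s"
  using assms
proof (induction rule: rtranclp_induct)
  case (step Y X)
  then show ?case
    using cobordism_sequence.eqv_step[of semiwelded_diagram semiwelded_move sad Z Y b d s X]
    by (simp add: semiwelded_step_def)
qed


section \<open>Reordering the feet on the distinguished circle\<close>

definition adjacent_swap :: "'a list \<Rightarrow> 'a list \<Rightarrow> bool" where
  "adjacent_swap xs ys \<longleftrightarrow> (\<exists>u x y v. xs = u @ x # y # v \<and> ys = u @ y # x # v)"

lemma adjacent_swaps_Cons: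
  "adjacent_swap\<^sup>*\<^sup>* xs ys \<Longrightarrow> adjacent_swap\<^sup>*\<^sup>* (x # xs) (x # ys)"
proof (induction rule: rtranclp_induct)
  case (step ys zs)
  from step(2) obtain u y z v where "ys = u @ y # z # v" "zs = u @ z # y # v"
    unfolding adjacent_swap_def by blast
  then have "adjacent_swap (x # ys) (x # zs)"
    unfolding adjacent_swap_def by (intro exI[of _ "x # u"]) auto
  then show ?case using step(3) by auto
qed simp

lemma adjacent_swaps_to_front: "adjacent_swap\<^sup>*\<^sup>* (u @ y # v) (y # u @ v)"
proof (induction u)
  case (Cons x u)
  have "adjacent_swap (x # y # u @ v) (y # x # u @ v)"
    unfolding adjacent_swap_def by (intro exI[of _ "[]"]) auto
  then show ?case using adjacent_swaps_Cons[OF Cons, of x] by auto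
qed simp

text \<open>Insertion sort: the first letter of the target is carried to the front by swaps, and the
  induction hypothesis arranges the rest.\<close>

lemma mset_eq_adjacent_swaps: "mset xs = mset ys \<Longrightarrow> adjacent_swap\<^sup>*\<^sup>* xs ys"
proof (induction ys arbitrary: xs)
  case (Cons y t)
  then have "y \<in> set xs" by (metis list.set_intros(1) set_mset_mset)
  then obtain u v where xs: "xs = u @ y # v" by (meson split_list)
  then have "mset (u @ v) = mset t" using Cons.prems by simp
  then have "adjacent_swap\<^sup>*\<^sup>* (y # u @ v) (y # t)"
    by (intro adjacent_swaps_Cons Cons.IH)
  then show ?case
    unfolding xs by (rule rtranclp_trans[OF adjacent_swaps_to_front])
qed simp

text \<open>The overpass move applies a transposition to all words of the diagram. Every end occurs
  only once, so away from the two swapped feet nothing changes.\<close>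

lemma adjacent_swap_equiv:
  fixes Z :: "'a gauss"
  assumes Z: "semiwelded_diagram Z" "circles Z = w # cs" "set w \<subseteq> range Foot"
    and sw: "adjacent_swap w w'"
  shows "Z \<approx> Z\<lparr>circles := w' # cs\<rparr>"
proof -
  obtain u p q v where w: "w = u @ p # q # v" "w' = u @ q # p # v"
    using sw unfolding adjacent_swap_def by blast
  obtain x y where xy: "p = Foot x" "q = Foot y" using Z(3) w(1) by auto
  have dist: "distinct (w @ concat cs)"
    using Z(1,2) by (simp add: semiwelded_diagram_def gauss_diagram_def)
  let ?\<tau> = "Transposition.transpose p q"
  have id: "map ?\<tau> c = c" if "p \<notin> set c" "q \<notin> set c" for c
    using that by (induction c) (auto simp: transpose_def)
  have "map ?\<tau> w = w'"
    using dist unfolding w by (simp add: id)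
  moreover have "map (map ?\<tau>) cs = cs"
    using dist unfolding w by (intro map_idI id) auto
  ultimately have Z': "Z\<lparr>circles := w' # cs\<rparr> = move_points ?\<tau> Z"
    by (simp add: move_points_def Z(2))
  have "semiwelded_diagram (Z\<lparr>circles := w' # cs\<rparr>)"
    using Z(1,2) by (auto simp: semiwelded_diagram_def gauss_diagram_def points_def arrows_def w)
  moreover have "next_to Z p q"
    using next_to_middle[of u p q v Z] Z(2) w(1) by simp
  then have "omega_overpass_move Z (Z\<lparr>circles := w' # cs\<rparr>)"
    unfolding omega_overpass_move_def Z' adjacent_def
    using dist by (intro exI[of _ x] exI[of _ y]) (auto simp: Z(2) w xy)
  ultimately show ?thesis
    using Z(1) by (intro semiwelded_equiv_step) (auto simp: semiwelded_move_def)
qed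

lemma omega_reorder:
  assumes Z: "semiwelded_diagram Z" "circles Z = w # cs" "set w \<subseteq> range Foot"
    and w': "distinct w'" "set w' = set w"
  shows "Z \<approx> Z\<lparr>circles := w' # cs\<rparr>"
proof -
  have "distinct w"
    using Z(1,2) by (simp add: semiwelded_diagram_def gauss_diagram_def)
  then have "adjacent_swap\<^sup>*\<^sup>* w w'"
    using w' by (intro mset_eq_adjacent_swaps) (simp add: set_eq_iff_mset_eq_distinct)
  then have "Z \<approx> Z\<lparr>circles := w' # cs\<rparr> \<and> semiwelded_diagram (Z\<lparr>circles := w' # cs\<rparr>) \<and>
      set w' \<subseteq> range Foot"
  proof (induction rule: rtranclp_induct)
    case base
    have "Z\<lparr>circles := w # cs\<rparr> = Z" unfolding Z(2)[symmetric] by simp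
    then show ?case unfolding \<open>Z\<lparr>circles := w # cs\<rparr> = Z\<close> using Z by simp
  next
    case (step x y)
    have "Z\<lparr>circles := x # cs\<rparr> \<approx> Z\<lparr>circles := y # cs\<rparr>"
      using adjacent_swap_equiv[of "Z\<lparr>circles := x # cs\<rparr>" x cs y] step by simp
    moreover have "set y = set x" using step(2) by (auto simp: adjacent_swap_def)
    moreover have "semiwelded_diagram (Z\<lparr>circles := y # cs\<rparr>)"
      using step.IH step(2)
      by (auto simp: semiwelded_diagram_def gauss_diagram_def points_def arrows_def adjacent_swap_def)
    ultimately show ?case using step.IH by (auto intro: rtranclp_trans)
  qed
  then show ?thesis by blast
qed



section \<open>Diagrams decorated by overcrossings of the distinguished circle\<close>

text \<open>The slot \<open>(p, False)\<close> lies just before the point \<open>p\<close>, and \<open>(p, True)\<close> just after it; so each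
  edge consists of two slots. A decoration \<open>M\<close> lists the signs of the marks in each slot.\<close>

type_synonym 'a slot = "'a endpoint \<times> bool"

definition slots :: "'a gauss \<Rightarrow> 'a slot set" where
  "slots D = points D \<times> UNIV"

definition block :: "('a slot \<Rightarrow> 'a zh_arrow list) \<Rightarrow> 'a endpoint \<Rightarrow> 'a zh_arrow endpoint list" where
  "block P p = map Head (P (p, False)) @ map_endpoint Given p # map Head (P (p, True))"

definition labels :: "'a gauss \<Rightarrow> ('a slot \<Rightarrow> 'a zh_arrow list) \<Rightarrow> 'a zh_arrow set" where
  "labels D P = (\<Union>t\<in>slots D. set (P t))"

text \<open>\<open>P\<close> names the marks in each slot while \<open>M\<close> keeps only their
  signs; the word \<open>w\<close> on \<omega> may list the feet in any order. Conditions on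
  \<open>P\<close> and \<open>M\<close> are imposed at the slots of \<open>D\<close> only.\<close>

definition realizes_via ::
  "'a zh_arrow endpoint list \<Rightarrow> ('a slot \<Rightarrow> 'a zh_arrow list) \<Rightarrow> 'a zh_arrow gauss \<Rightarrow> 'a gauss \<Rightarrow>
   ('a slot \<Rightarrow> int list) \<Rightarrow> bool" where
  "realizes_via w P Z D M \<longleftrightarrow>
     circles Z = w # map (\<lambda>c. concat (map (block P) c)) (circles D) \<and>
     (\<forall>a\<in>arrows D. arrow_sign Z (Given a) = arrow_sign D a) \<and>
     distinct w \<and> set w = Foot ` labels D P \<and> labels D P \<inter> range Given = {} \<and>
     (\<forall>t\<in>slots D. distinct (P t) \<and> map (arrow_sign Z) (P t) = M t \<and> set (M t) \<subseteq> {1, -1}) \<and>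
     (\<forall>t\<in>slots D. \<forall>t'\<in>slots D. t \<noteq> t' \<longrightarrow> set (P t) \<inter> set (P t') = {})"

definition realizes :: "'a zh_arrow gauss \<Rightarrow> 'a gauss \<Rightarrow> ('a slot \<Rightarrow> int list) \<Rightarrow> bool" where
  "realizes Z D M \<longleftrightarrow> (\<exists>w P. realizes_via w P Z D M)"

lemma in_slots [simp]: "(p, b) \<in> slots D \<longleftrightarrow> p \<in> points D"
  by (simp add: slots_def)

lemma in_block:
  "Foot l \<in> set (block P p) \<longleftrightarrow> (\<exists>a. l = Given a \<and> p = Foot a)"
  "Head l \<in> set (block P p) \<longleftrightarrow> l \<in> set (P (p, False)) \<union> set (P (p, True)) \<or>
     (\<exists>a. l = Given a \<and> p = Head a)"
  unfolding block_def by (cases p; auto)+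

lemma arrow_in_arrows:
  assumes "gauss_diagram D"
  shows "a \<in> arrows D \<longleftrightarrow> Foot a \<in> points D" "a \<in> arrows D \<longleftrightarrow> Head a \<in> points D"
proof -
  have "Foot a \<in> points D \<longleftrightarrow> Head a \<in> points D"
    using assms by (simp add: gauss_diagram_def)
  moreover have "a \<in> arrows D \<longleftrightarrow> Foot a \<in> points D \<or> Head a \<in> points D"
    unfolding arrows_def image_iff by (metis arrow_of.simps endpoint.exhaust)
  ultimately show "a \<in> arrows D \<longleftrightarrow> Foot a \<in> points D" "a \<in> arrows D \<longleftrightarrow> Head a \<in> points D"
    by auto
qed

lemma realizes_points:
  assumes "realizes_via w P Z D M" and gauss: "gauss_diagram D"
  shows "Foot l \<in> points Z \<longleftrightarrow> l \<in> labels D P \<or> (\<exists>a. l = Given a \<and> a \<in> arrows D)"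
    and "Head l \<in> points Z \<longleftrightarrow> l \<in> labels D P \<or> (\<exists>a. l = Given a \<and> a \<in> arrows D)"
    and "l \<in> arrows Z \<longleftrightarrow> l \<in> labels D P \<or> (\<exists>a. l = Given a \<and> a \<in> arrows D)"
proof -
  have c: "circles Z = w # map (\<lambda>c. concat (map (block P) c)) (circles D)"
    and w: "set w = Foot ` labels D P"
    using assms(1) by (auto simp: realizes_via_def)
  have pts: "points Z = Foot ` labels D P \<union> (\<Union>p\<in>points D. set (block P p))"
    unfolding points_def c by (auto simp: w)
  show F: "Foot l \<in> points Z \<longleftrightarrow> l \<in> labels D P \<or> (\<exists>a. l = Given a \<and> a \<in> arrows D)"
    unfolding pts by (auto simp: in_block arrow_in_arrows(1)[OF gauss])
  have "(\<exists>p\<in>points D. l \<in> set (P (p, False)) \<union> set (P (p, True))) \<longleftrightarrow> l \<in> labels D P"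
    unfolding labels_def slots_def by (auto) (metis (full_types))
  then show H: "Head l \<in> points Z \<longleftrightarrow> l \<in> labels D P \<or> (\<exists>a. l = Given a \<and> a \<in> arrows D)"
    unfolding pts by (auto simp: in_block arrow_in_arrows(2)[OF gauss])
  have "l \<in> arrows Z \<longleftrightarrow> Foot l \<in> points Z \<or> Head l \<in> points Z"
    unfolding arrows_def image_iff by (metis arrow_of.simps endpoint.exhaust)
  then show "l \<in> arrows Z \<longleftrightarrow> l \<in> labels D P \<or> (\<exists>a. l = Given a \<and> a \<in> arrows D)"
    using F H by blast
qed

text \<open>Marks in different slots have different labels, all distinct from the labels of given
  arrows, and every mark has exactly one foot, on \<omega>; hence no end is repeated and every arrow
  is complete.\<close>

lemma realizes_semiwelded:
  assumes R: "realizes_via w P Z D M" and gauss: "gauss_diagram D"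
  shows "semiwelded_diagram Z"
proof -
  have c: "circles Z = w # map (\<lambda>c. concat (map (block P) c)) (circles D)"
    and s: "\<And>a. a \<in> arrows D \<Longrightarrow> arrow_sign Z (Given a) = arrow_sign D a"
    and w: "distinct w" "set w = Foot ` labels D P"
    and G: "labels D P \<inter> range Given = {}"
    and dP: "\<And>t. t \<in> slots D \<Longrightarrow> distinct (P t)"
    and M: "\<And>t. t \<in> slots D \<Longrightarrow> map (arrow_sign Z) (P t) = M t"
      "\<And>t. t \<in> slots D \<Longrightarrow> set (M t) \<subseteq> {1, -1}"
    and disj: "\<And>t t'. t \<in> slots D \<Longrightarrow> t' \<in> slots D \<Longrightarrow> t \<noteq> t' \<Longrightarrow> set (P t) \<inter> set (P t') = {}"
    using R by (auto simp: realizes_via_def)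
  have G': "Given a \<notin> set (P (p, b))" if "p \<in> points D" for a p b
    using G that in_slots unfolding labels_def by (metis UN_I disjoint_iff rangeI)
  have "distinct (concat (map (block P) ps))" if "set ps \<subseteq> points D" "distinct ps" for ps
    using that
  proof (induction ps)
    case (Cons p ps)
    then have p: "p \<in> points D" by simp
    have "distinct (block P p)"
      using dP[of "(p, False)"] dP[of "(p, True)"] disj[of "(p, False)" "(p, True)"] G'[OF p] p
      unfolding block_def by (cases p) (auto simp: distinct_map inj_on_def)
    moreover have "set (block P p) \<inter> set (block P q) = {}" if q: "q \<in> set ps" for q
    proof -
      have q': "q \<in> points D" "q \<noteq> p" using q Cons.prems by auto
      have "set (P (p, b)) \<inter> set (P (q, b')) = {}" for b b'
        using disj[of "(p, b)" "(q, b')"] p q' by auto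
      then have "l \<in> set (block P p) \<Longrightarrow> l \<notin> set (block P q)" for l
        using G'[OF p] G'[OF q'(1)] q'(2) by (cases l) (auto simp: in_block)
      then show ?thesis by blast
    qed
    ultimately show ?case using Cons by auto
  qed simp
  moreover have "concat (map (\<lambda>c. concat (map g c)) cs) = concat (map g (concat cs))"
    for g :: "'a endpoint \<Rightarrow> 'a zh_arrow endpoint list" and cs
    by (induction cs) auto
  then have "concat (circles Z) = w @ concat (map (block P) (concat (circles D)))"
    unfolding c by simp
  moreover have "set w \<inter> set (concat (map (block P) (concat (circles D)))) = {}"
  proof -
    have "Given a \<notin> labels D P" for a using G by blast
    then show ?thesis unfolding w(2) by (auto simp: in_block)
  qed
  ultimately have "distinct (concat (circles Z))"
    using w(1) gauss by (simp add: gauss_diagram_def points_def)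
  moreover have "Foot a \<in> points Z \<longleftrightarrow> Head a \<in> points Z" for a
    using realizes_points[OF R gauss] by simp
  moreover have "arrow_sign Z l \<in> {1, -1}" if "l \<in> arrows Z" for l
  proof (cases "l \<in> labels D P")
    case True
    then obtain t where "t \<in> slots D" "l \<in> set (P t)" by (auto simp: labels_def)
    then have "arrow_sign Z l \<in> set (M t)" using M(1) by (metis image_eqI list.set_map)
    then show ?thesis using M(2)[OF \<open>t \<in> slots D\<close>] by blast
  next
    case False
    then show ?thesis
      using realizes_points(3)[OF R gauss, of l] that s gauss by (auto simp: gauss_diagram_def)
  qed
  ultimately show ?thesis
    by (auto simp: semiwelded_diagram_def gauss_diagram_def c)
qed

lemma realizes_reorder:
  assumes R: "realizes_via w P Z D M" and gauss: "gauss_diagram D"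
    and w': "distinct w'" "set w' = set w"
  obtains Z' where "realizes_via w' P Z' D M" "Z \<approx> Z'" "arrow_sign Z' = arrow_sign Z"
proof
  let ?Z = "Z\<lparr>circles := w' # map (\<lambda>c. concat (map (block P) c)) (circles D)\<rparr>"
  show "arrow_sign ?Z = arrow_sign Z" by simp
  show "realizes_via w' P ?Z D M" using R w' by (simp add: realizes_via_def)
  show "Z \<approx> ?Z"
    using R w' by (intro omega_reorder[OF realizes_semiwelded[OF R gauss]])
      (auto simp: realizes_via_def)
qed

lemma realizes_cong:
  assumes "\<And>t. t \<in> slots D \<Longrightarrow> M t = M' t"
  shows "realizes Z D M \<longleftrightarrow> realizes Z D M'"
  unfolding realizes_def realizes_via_def using assms by auto

text \<open>Two realizations of one decoration differ only in the names of the marks and in the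
  order of the feet on \<omega>; the names are matched by slot and place, the order is changed by
  overpass moves.\<close>

lemma realizations_equiv:
  assumes "realizes Z D M" "realizes Z' D M" and gauss: "gauss_diagram D"
  shows "Z \<approx> Z'"
proof -
  obtain w P where R: "realizes_via w P Z D M" using assms(1) by (auto simp: realizes_def)
  obtain w' P' where R': "realizes_via w' P' Z' D M" using assms(2) by (auto simp: realizes_def)
  have len: "length (P t) = length (P' t)" if "t \<in> slots D" for t
    using R R' that unfolding realizes_via_def by (metis length_map)
  define new where "new l l' \<longleftrightarrow> (\<exists>t\<in>slots D. \<exists>i<length (P t). P t ! i = l \<and> P' t ! i = l')" for l l'
  have inj1: "t = t' \<and> i = j"
    if "realizes_via v Q Y D N" "t \<in> slots D" "i < length (Q t)" "t' \<in> slots D" "j < length (Q t')"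
      "Q t ! i = Q t' ! j" for t t' i j v Q Y N
  proof -
    have "t = t'"
      using that unfolding realizes_via_def by (metis disjoint_iff nth_mem)
    then show ?thesis using that by (auto simp: realizes_via_def nth_eq_iff_index_eq)
  qed
  \<comment> \<open>The choice is determined, since a label occurs at only one place of one
    slot.\<close>
  define f where "f l = (if l \<in> range Given then l else SOME l'. new l l')" for l
  have fG: "f (Given a) = Given a" for a by (simp add: f_def)
  have fP: "f (P t ! i) = P' t ! i" if t: "t \<in> slots D" "i < length (P t)" for t i
  proof -
    have "P t ! i \<in> labels D P" unfolding labels_def using t by (metis UN_I nth_mem)
    then have "P t ! i \<notin> range Given" using R by (auto simp: realizes_via_def)
    moreover have "new (P t ! i) = (\<lambda>l'. l' = P' t ! i)"
      unfolding new_def using t inj1[OF R] by (intro ext) metis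
    ultimately show ?thesis by (simp add: f_def)
  qed
  have mapP: "map f (P t) = P' t" if "t \<in> slots D" for t
    using that len by (intro nth_equalityI) (auto simp: fP)
  have block: "map (map_endpoint f) (block P p) = block P' p" if "p \<in> points D" for p
  proof -
    have "map f (P (p, b)) = P' (p, b)" for b using mapP[of "(p, b)"] that by simp
    then have "map (map_endpoint f) (map Head (P (p, b))) = map Head (P' (p, b))" for b
      unfolding map_map comp_def by (simp flip: map_map[of Head f, unfolded comp_def])
    then show ?thesis unfolding block_def by (cases p) (auto simp: fG)
  qed
  have labs: "labels D P' = f ` labels D P"
    unfolding labels_def using mapP by (simp add: image_UN flip: list.set_map)
  have blocks: "map (map_endpoint f) (concat (map (block P) c)) = concat (map (block P') c)"
    if "c \<in> set (circles D)" for c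
    using that unfolding map_concat map_map comp_def
    by (intro arg_cong[of _ _ concat] map_cong refl block) (auto simp: points_def)
  have injf: "inj_on f (labels D P)"
  proof (rule inj_onI)
    fix l l' assume "l \<in> labels D P" "l' \<in> labels D P" and eq: "f l = f l'"
    then obtain t i t' i' where "t \<in> slots D" "i < length (P t)" "l = P t ! i"
       "t' \<in> slots D" "i' < length (P t')" "l' = P t' ! i'"
      unfolding labels_def by (metis UN_E in_set_conv_nth)
    then show "l = l'" using inj1[OF R', of t i t' i'] eq by (auto simp: fP len)
  qed
  \<comment> \<open>\<open>Z'\<close> is rearranged so that its \<omega> reads the renamed word of
    \<open>Z\<close>; after that the renaming is an isomorphism which keeps the numbering of the
    circles and all base points.\<close>
  define w1 where "w1 = map (map_endpoint f) w"
  have w1: "distinct w1" "set w1 = set w'"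
  proof -
    have w: "distinct w" "set w = Foot ` labels D P" "set w' = Foot ` labels D P'"
      using R R' by (auto simp: realizes_via_def)
    show "distinct w1" unfolding w1_def distinct_map
      using w injf by (auto simp: inj_on_def)
    show "set w1 = set w'" by (simp add: w1_def w labs image_image)
  qed
  obtain Z1 where R1: "realizes_via w1 P' Z1 D M" and Z1: "Z' \<approx> Z1"
    using realizes_reorder[OF R' gauss w1] by blast
  have sG: "arrow_sign Z1 (Given a) = arrow_sign Z (Given a)" if "a \<in> arrows D" for a
    using R R1 that by (simp add: realizes_via_def)
  have sl: "arrow_sign Z1 (f l) = arrow_sign Z l" if l: "l \<in> labels D P" for l
  proof -
    obtain t i where t: "t \<in> slots D" "i < length (P t)" "l = P t ! i"
      using l unfolding labels_def by (metis UN_E in_set_conv_nth)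
    then have "arrow_sign Z1 (P' t ! i) = M t ! i" "arrow_sign Z (P t ! i) = M t ! i"
      using R R1 len unfolding realizes_via_def by (metis nth_map)+
    then show ?thesis using t by (simp add: fP)
  qed
  have "inj_on f (arrows Z)"
  proof (rule inj_onI)
    fix l l' assume l: "l \<in> arrows Z" "l' \<in> arrows Z" "f l = f l'"
    have "f l \<notin> range Given" if "l \<in> labels D P" for l
      using that R' labs by (auto simp: realizes_via_def)
    then show "l = l'"
      using l injf unfolding realizes_points(3)[OF R gauss]
      by (metis fG inj_onD rangeI)
  qed
  moreover have "\<forall>l\<in>arrows Z. arrow_sign Z1 (f l) = arrow_sign Z l"
    using sl fG sG realizes_points(3)[OF R gauss] by metis
  moreover have "circles Z1 = map (map (map_endpoint f)) (circles Z)"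
    using R R1 blocks by (simp add: realizes_via_def w1_def)
  moreover have "rotate 0 c = c" for c :: "'a zh_arrow endpoint list" by simp
  ultimately have "same_diagram_via id Z Z1"
    unfolding same_diagram_via_def
    by (simp add: permutes_id) (metis nth_map rotate0 id_apply)
  then have "semiwelded_move Z Z1"
    unfolding semiwelded_move_def by (metis id_apply)
  then have "Z \<approx> Z1"
    using realizes_semiwelded R R1 gauss by (intro semiwelded_equiv_step) auto
  then show ?thesis using semiwelded_equiv_sym[OF Z1] by (rule rtranclp_trans)
qed

section \<open>Existence of realizations, and removal of arrows and marks\<close>

text \<open>A label encodes the end, the side and the place within the slot, so no two marks share a
  label, however long the lists in \<open>M\<close> are.\<close>

lemma realization_exists:
  fixes D :: "nat gauss"
  assumes "\<And>t. t \<in> slots D \<Longrightarrow> set (M t) \<subseteq> {1, -1}"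
  obtains Z where "realizes Z D M"
proof -
  define code where "code p = (case p of Foot a \<Rightarrow> 2 * a | Head a \<Rightarrow> 2 * a + 1)" for p :: "nat endpoint"
  \<comment> \<open>\<open>AtFoot\<close> and \<open>AtHead\<close> merely provide two disjoint
    families of labels here, for the slots before and after an end; they do not say whether that end
    is a foot or a head.\<close>
  define lab where "lab t i = (if snd t then AtHead else AtFoot) (prod_encode (code (fst t), i))"
    for t :: "nat slot" and i :: nat
  have code: "code p = code q \<longleftrightarrow> p = q" for p q
    by (cases p; cases q) (auto simp: code_def, presburger+)
  have lab: "lab t i = lab t' j \<longleftrightarrow> t = t' \<and> i = j" for t t' i j
    by (cases t; cases t') (auto simp: lab_def code)
  have notG: "lab t i \<notin> range Given" for t i by (auto simp: lab_def)
  define P where "P t = map (lab t) [0..<length (M t)]" for t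
  have "finite (Foot ` labels D P)"
    by (simp add: labels_def slots_def points_def)
  then obtain w where w: "set w = Foot ` labels D P" "distinct w"
    using finite_distinct_list by metis
  define \<sigma> where "\<sigma> l = (case l of Given a \<Rightarrow> arrow_sign D a
    | _ \<Rightarrow> (SOME s. \<exists>t i. l = lab t i \<and> s = M t ! i))" for l
  have \<sigma>: "\<sigma> (lab t i) = M t ! i" for t i
  proof -
    have "(SOME s. \<exists>t' i'. lab t i = lab t' i' \<and> s = M t' ! i') = M t ! i"
      by (simp add: lab)
    moreover have "\<sigma> (lab t i) = (SOME s. \<exists>t' i'. lab t i = lab t' i' \<and> s = M t' ! i')"
      unfolding \<sigma>_def by (cases "lab t i") (use notG[of t i] in auto)
    ultimately show ?thesis by simp
  qed
  have "realizes_via w P \<lparr>circles = w # map (\<lambda>c. concat (map (block P) c)) (circles D),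
      arrow_sign = \<sigma>\<rparr> D M"
    unfolding realizes_via_def
  proof (simp add: w, intro conjI ballI impI)
    show "\<sigma> (Given a) = arrow_sign D a" for a by (simp add: \<sigma>_def)
    show "labels D P \<inter> range Given = {}"
    proof -
      have "l \<notin> range Given" if l: "l \<in> labels D P" for l
      proof -
        obtain t i where "l = lab t i" using l by (auto simp: labels_def P_def)
        then show ?thesis using notG by simp
      qed
      then show ?thesis by blast
    qed
    fix t assume "t \<in> slots D"
    then show "set (M t) \<subseteq> {1, -1}" using assms by auto
    show "distinct (P t)" by (auto simp: P_def distinct_map inj_on_def lab)
    show "map \<sigma> (P t) = M t" by (intro nth_equalityI) (auto simp: P_def \<sigma>)
    show "set (P t) \<inter> set (P t') = {}" if "t \<noteq> t'" for t'
      using that by (auto simp: P_def lab)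
  qed
  then show thesis using that by (auto simp: realizes_def)
qed

lemma gauss_diagram_remove:
  assumes "gauss_diagram D"
  shows "gauss_diagram (remove_arrows A D)"
proof -
  have pts: "points (remove_arrows A D) = {p \<in> points D. arrow_of p \<notin> A}"
    by (auto simp: points_def remove_arrows_def)
  have "distinct (concat (map (filter Q) cs))" if "distinct (concat cs)" for cs Q
    using that by (induction cs) auto
  then show ?thesis
    using assms unfolding gauss_diagram_def arrows_def pts
    by (auto simp: remove_arrows_def)
qed

text \<open>Marks are recorded relative to ends of arrows, so an arrow may be deleted only together
  with all marks in its slots. The hypothesis \<open>L\<close> says this; then each block is either
  deleted completely or loses some marks.\<close>

lemma realizes_remove:
  assumes R: "realizes_via w P Z D M"
    and L: "\<And>p b l. p \<in> points D \<Longrightarrow> Given (arrow_of p) \<in> L \<Longrightarrow> l \<in> set (P (p, b)) \<Longrightarrow> l \<in> L"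
  shows "realizes_via (filter (\<lambda>p. arrow_of p \<notin> L) w) (\<lambda>t. filter (\<lambda>l. l \<notin> L) (P t))
    (remove_arrows L Z) (remove_arrows {a. Given a \<in> L} D)
    (\<lambda>t. map (arrow_sign Z) (filter (\<lambda>l. l \<notin> L) (P t)))"
proof -
  let ?P = "\<lambda>t. filter (\<lambda>l. l \<notin> L) (P t)"
  let ?D = "remove_arrows {a. Given a \<in> L} D"
  have pts: "points ?D = {p \<in> points D. Given (arrow_of p) \<notin> L}"
    by (auto simp: points_def remove_arrows_def)
  have slots: "slots ?D = {t \<in> slots D. Given (arrow_of (fst t)) \<notin> L}"
    unfolding slots_def pts by auto
  have arr: "arrows ?D \<subseteq> arrows D" unfolding arrows_def pts by auto
  have labs: "labels ?D ?P = {l \<in> labels D P. l \<notin> L}"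
  proof (intro equalityI subsetI)
    fix l assume "l \<in> {l \<in> labels D P. l \<notin> L}"
    then obtain p b where "p \<in> points D" "l \<in> set (P (p, b))" "l \<notin> L"
      by (auto simp: labels_def slots_def)
    then have "(p, b) \<in> slots ?D" "l \<in> set (?P (p, b))"
      using L[of p l b] by (auto simp: slots)
    then show "l \<in> labels ?D ?P" unfolding labels_def by blast
  qed (auto simp: labels_def slots)
  have "filter (\<lambda>p. arrow_of p \<notin> L) (concat (map (block P) c)) =
      concat (map (block ?P) (filter (\<lambda>p. arrow_of p \<notin> {a. Given a \<in> L}) c))"
    if "set c \<subseteq> points D" for c
    using that
  proof (induction c)
    case (Cons p c)
    have H: "filter (\<lambda>p. arrow_of p \<notin> L) (map Head xs) = map Head (filter (\<lambda>l. l \<notin> L) xs)" for xs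
      by (induction xs) auto
    have g: "arrow_of (map_endpoint Given p) = Given (arrow_of p)" by (cases p) auto
    have "filter (\<lambda>l. l \<notin> L) (P (p, b)) = []" if "Given (arrow_of p) \<in> L" for b
      using L[of p] that Cons.prems by (auto simp: filter_empty_conv)
    then have "filter (\<lambda>p. arrow_of p \<notin> L) (block P p) = (if Given (arrow_of p) \<in> L then [] else block ?P p)"
      by (auto simp: block_def H g)
    then show ?case using Cons by simp
  qed simp
  then have "map (filter (\<lambda>p. arrow_of p \<notin> L)) (map (\<lambda>c. concat (map (block P) c)) (circles D)) =
    map (\<lambda>c. concat (map (block ?P) c)) (circles ?D)"
    by (auto simp: remove_arrows_def points_def)
  moreover have "set (map (arrow_sign Z) (?P t)) \<subseteq> {1, -1}" if "t \<in> slots D" for t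
  proof -
    have "set (map (arrow_sign Z) (P t)) \<subseteq> {1, -1}"
      using R that by (simp add: realizes_via_def)
    then show ?thesis by auto
  qed
  ultimately have cs: "circles (remove_arrows L Z) = filter (\<lambda>p. arrow_of p \<notin> L) w #
      map (\<lambda>c. concat (map (block ?P) c)) (circles ?D)"
    and sg: "\<And>t. t \<in> slots D \<Longrightarrow> set (map (arrow_sign Z) (?P t)) \<subseteq> {1, -1}"
    using R by (simp_all add: realizes_via_def remove_arrows_def[of L Z])
  have sign: "arrow_sign (remove_arrows L Z) = arrow_sign Z" "arrow_sign ?D = arrow_sign D"
    by (simp_all add: remove_arrows_def)
  have sub: "t \<in> slots D" if "t \<in> slots ?D" for t using that slots by simp
  show ?thesis
    unfolding realizes_via_def sign
  proof (intro conjI ballI impI)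
    show "circles (remove_arrows L Z) = filter (\<lambda>p. arrow_of p \<notin> L) w #
      map (\<lambda>c. concat (map (block ?P) c)) (circles ?D)" by (fact cs)
    show "arrow_sign Z (Given a) = arrow_sign D a" if "a \<in> arrows ?D" for a
      using R that arr unfolding realizes_via_def by blast
    show "distinct (filter (\<lambda>p. arrow_of p \<notin> L) w)"
      using R by (simp add: realizes_via_def)
    show "set (filter (\<lambda>p. arrow_of p \<notin> L) w) = Foot ` labels ?D ?P"
      using R unfolding labs realizes_via_def by auto
    show "labels ?D ?P \<inter> range Given = {}"
      using R unfolding labs realizes_via_def by auto
    fix t assume t: "t \<in> slots ?D"
    show "distinct (?P t)" using R sub[OF t] by (simp add: realizes_via_def)
    show "set (map (arrow_sign Z) (?P t)) \<subseteq> {1, -1}" by (rule sg[OF sub[OF t]])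
    show "set (?P t) \<inter> set (?P t') = {}" if "t' \<in> slots ?D" "t \<noteq> t'" for t'
    proof -
      have "set (P t) \<inter> set (P t') = {}"
        using R sub[OF t] sub[OF that(1)] that(2) by (simp add: realizes_via_def)
      then show ?thesis by auto
    qed
  qed simp
qed

text \<open>Reordering makes the feet neighbours on \<omega>; as the heads are neighbours on another
  circle and the signs are opposite, the two arrows bound a bigon.\<close>

lemma omega_cancel:
  assumes R: "realizes_via w P Z D M" and gauss: "gauss_diagram D"
    and l: "l1 \<in> labels D P" "l2 \<in> labels D P" "l1 \<noteq> l2" "arrow_sign Z l1 = - arrow_sign Z l2"
    and c: "c \<in> set (tl (circles Z))" "rotate k c = Head l1 # Head l2 # r"
  defines "P' \<equiv> \<lambda>t. filter (\<lambda>l. l \<notin> {l1, l2}) (P t)"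
  obtains w' Z' where "Z \<approx> Z'" "realizes_via w' P' Z' D (\<lambda>t. map (arrow_sign Z) (P' t))"
proof -
  have w: "distinct w" "set w = Foot ` labels D P" and G: "labels D P \<inter> range Given = {}"
    and cs: "circles Z = w # map (\<lambda>c. concat (map (block P) c)) (circles D)"
    using R by (auto simp: realizes_via_def)
  let ?v = "filter (\<lambda>p. p \<notin> {Foot l1, Foot l2}) w"
  let ?w = "Foot l1 # Foot l2 # ?v"
  have "distinct ?w" "set ?w = set w" using w l by auto
  then obtain Z1 where R1: "realizes_via ?w P Z1 D M" and Z1: "Z \<approx> Z1"
    and s: "arrow_sign Z1 = arrow_sign Z"
    using realizes_reorder[OF R gauss] by blast
  have c1: "circles Z1 = ?w # map (\<lambda>c. concat (map (block P) c)) (circles D)"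
    using R1 by (simp add: realizes_via_def)
  have "next_to Z1 (Foot l1) (Foot l2)"
    using next_to_middle[of "[]" "Foot l1" "Foot l2" ?v Z1] by (simp add: c1)
  moreover have "next_to Z1 (Head l1) (Head l2)"
    using c by (intro next_toI[of c Z1 k _ _ r]) (auto simp: cs c1)
  ultimately have "R2_removal Z1 (remove_arrows {l1, l2} Z1)"
    unfolding R2_removal_def adjacent_def using l s by (intro exI[of _ l1] exI[of _ l2]) auto
  then have "semiwelded_move Z1 (remove_arrows {l1, l2} Z1)"
    by (simp add: semiwelded_move_def reidemeister_move_def)
  moreover have nG: "Given a \<noteq> l1" "Given a \<noteq> l2" for a using G l by auto
  have "remove_arrows {a. Given a \<in> {l1, l2}} D = D"
    using nG by (simp add: remove_arrows_def map_idI)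
  then have R2: "realizes_via (filter (\<lambda>p. arrow_of p \<notin> {l1, l2}) ?w) P'
      (remove_arrows {l1, l2} Z1) D (\<lambda>t. map (arrow_sign Z) (P' t))"
    using realizes_remove[OF R1, of "{l1, l2}"] nG by (simp add: P'_def s)
  ultimately have "Z1 \<approx> remove_arrows {l1, l2} Z1"
    using realizes_semiwelded[OF R1 gauss] realizes_semiwelded[OF R2 gauss]
    by (intro semiwelded_equiv_step)
  then show thesis using that[OF _ R2] Z1 by (meson rtranclp_trans)
qed

section \<open>Equivalence of decorations\<close>

definition signs :: "'a gauss \<Rightarrow> ('a slot \<Rightarrow> int list) \<Rightarrow> bool" where
  "signs D M \<longleftrightarrow> (\<forall>t\<in>slots D. set (M t) \<subseteq> {1, -1})"

text \<open>Quantifying over all realizations makes the relation independent of labels. It holds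
  vacuously for a decoration without realizations.\<close>

definition decorated_equiv ::
  "'a gauss \<Rightarrow> ('a slot \<Rightarrow> int list) \<Rightarrow> 'a gauss \<Rightarrow> ('a slot \<Rightarrow> int list) \<Rightarrow> bool" where
  "decorated_equiv D M D' M' \<longleftrightarrow> (\<forall>Z Z'. realizes Z D M \<longrightarrow> realizes Z' D' M' \<longrightarrow> Z \<approx> Z')"

text \<open>One equivalent pair suffices, because realizations of the same decoration are
  equivalent.\<close>

lemma decorated_equivI:
  assumes "gauss_diagram D" "gauss_diagram D'"
    and "realizes Z D M" "realizes Z' D' M'" "Z \<approx> Z'"
  shows "decorated_equiv D M D' M'"
  unfolding decorated_equiv_def using assms realizations_equiv by (meson rtranclp_trans)

lemma decorated_equiv_refl: "gauss_diagram D \<Longrightarrow> decorated_equiv D M D M"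
  unfolding decorated_equiv_def using realizations_equiv by blast

lemma decorated_equiv_sym: "decorated_equiv D M D' M' \<Longrightarrow> decorated_equiv D' M' D M"
  unfolding decorated_equiv_def using semiwelded_equiv_sym by blast

text \<open>\<open>signs E N\<close> guarantees a realization in the middle, through which the two
  equivalences are composed.\<close>

lemma decorated_equiv_trans:
  fixes E :: "nat gauss"
  assumes "decorated_equiv D M E N" "decorated_equiv E N D' M'" "signs E N"
  shows "decorated_equiv D M D' M'"
proof -
  obtain Y where "realizes Y E N"
    using realization_exists[of E N] assms(3) by (auto simp: signs_def)
  then show ?thesis
    using assms(1,2) unfolding decorated_equiv_def by (meson rtranclp_trans)
qed

lemma decorated_equiv_cong:
  assumes "\<And>t. t \<in> slots D \<Longrightarrow> M t = N t" "\<And>t. t \<in> slots D' \<Longrightarrow> M' t = N' t"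
  shows "decorated_equiv D M D' M' \<longleftrightarrow> decorated_equiv D N D' N'"
  unfolding decorated_equiv_def
  using realizes_cong[of D M N] realizes_cong[of D' M' N'] assms by simp

text \<open>Neighbouring marks of one slot are consecutive heads in a block, hence on a circle other
  than \<omega>, and \<open>omega_cancel\<close> removes them.\<close>

lemma cancel_pair:
  fixes D :: "nat gauss"
  assumes gauss: "gauss_diagram D" and sgn: "signs D (M(t := u @ [s, - s] @ v))"
    and t: "t \<in> slots D"
  shows "decorated_equiv D (M(t := u @ [s, - s] @ v)) D (M(t := u @ v))"
proof -
  let ?M = "M(t := u @ [s, - s] @ v)"
  obtain Z where "realizes Z D ?M"
    using realization_exists[of D ?M] sgn unfolding signs_def by blast
  then obtain w P where R: "realizes_via w P Z D ?M" by (auto simp: realizes_def)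
  have Pt: "map (arrow_sign Z) (P t) = u @ [s, - s] @ v" "distinct (P t)"
    using R t unfolding realizes_via_def by fastforce+
  then obtain U l1 l2 V where P: "P t = U @ l1 # l2 # V" and
    UV: "map (arrow_sign Z) U = u" "map (arrow_sign Z) V = v" "arrow_sign Z l1 = s" "arrow_sign Z l2 = -s"
    by (auto simp: map_eq_append_conv)
  obtain p b where pb: "t = (p, b)" "p \<in> points D" using t by (cases t) auto
  obtain c where c: "c \<in> set (circles D)" "p \<in> set c" using pb by (auto simp: points_def)
  obtain c1 c2 where c12: "c = c1 @ p # c2" using c by (meson split_list)
  obtain j1 j2 where "block P p = j1 @ Head l1 # Head l2 # j2"
  proof (cases b)
    case True
    then show thesis
      using P pb(1) that[of "map Head (P (p, False)) @ map_endpoint Given p # map Head U"]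
      by (simp add: block_def)
  next
    case False
    then show thesis using P pb(1) that[of "map Head U"] by (simp add: block_def)
  qed
  then obtain k1 k2 where "concat (map (block P) c) = k1 @ Head l1 # Head l2 # k2"
    by (intro that[of "concat (map (block P) c1) @ j1" "j2 @ concat (map (block P) c2)"])
      (simp add: c12)
  moreover define cc where "cc = concat (map (block P) c)"
  ultimately have rot: "rotate (length k1) cc = Head l1 # Head l2 # k2 @ k1"
    by (simp add: rotate_append)
  have cc: "cc \<in> set (tl (circles Z))"
    using c(1) R unfolding realizes_via_def cc_def by simp
  have ls: "l1 \<in> labels D P" "l2 \<in> labels D P" "l1 \<noteq> l2"
    using P Pt(2) t by (force simp: labels_def)+
  obtain w' Z' where Z': "Z \<approx> Z'" "realizes_via w' (\<lambda>t. filter (\<lambda>l. l \<notin> {l1, l2}) (P t)) Z' D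
     (\<lambda>t. map (arrow_sign Z) (filter (\<lambda>l. l \<notin> {l1, l2}) (P t)))"
  proof (rule omega_cancel[OF R gauss ls _ cc rot])
    show "arrow_sign Z l1 = - arrow_sign Z l2" by (simp add: UV)
  qed
  have "map (arrow_sign Z) (filter (\<lambda>l. l \<notin> {l1, l2}) (P t')) = (M(t := u @ v)) t'"
    if t': "t' \<in> slots D" for t'
  proof (cases "t' = t")
    case True
    have "filter (\<lambda>l. l \<notin> {l1, l2}) U = U" "filter (\<lambda>l. l \<notin> {l1, l2}) V = V"
      using Pt(2) unfolding P by (auto simp: filter_id_conv)
    then show ?thesis using True P UV by simp
  next
    case False
    then have "set (P t) \<inter> set (P t') = {}" using R t t' by (auto simp: realizes_via_def)
    then have "filter (\<lambda>l. l \<notin> {l1, l2}) (P t') = P t'"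
      unfolding P by (auto simp: filter_id_conv)
    then show ?thesis using False R t' by (simp add: realizes_via_def)
  qed
  then have "realizes Z' D (M(t := u @ v))"
    using Z'(2) realizes_cong[of D "\<lambda>t. map (arrow_sign Z) (filter (\<lambda>l. l \<notin> {l1, l2}) (P t))"
      "M(t := u @ v)" Z'] unfolding realizes_def by metis
  then show ?thesis
    using decorated_equivI[OF gauss gauss _ _ Z'(1)] R unfolding realizes_def by blast
qed

section \<open>Only the sum of the signs in a slot matters\<close>

text \<open>The normal form of a slot: the shortest list of signs with sum \<open>n\<close>.\<close>

definition marks :: "int \<Rightarrow> int list" where
  "marks n = replicate (nat \<bar>n\<bar>) (sgn n)"

lemma set_marks: "set (marks n) \<subseteq> {1, -1}"
  by (auto simp: marks_def sgn_if)

lemma sum_list_marks [simp]: "sum_list (marks n) = n"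
  by (simp add: marks_def sum_list_replicate abs_mult_sgn)

lemma marks_simps [simp]: "marks 0 = []" "marks 1 = [1]" "marks (-1) = [-1]"
  by (simp_all add: marks_def)

text \<open>A new sign either lengthens the run or meets an opposite sign with which it
  cancels.\<close>

lemma Cons_marks:
  assumes "s \<in> {1, -1}"
  shows "s # marks n = marks (s + n) \<or> marks n = - s # marks (s + n)"
proof (cases "n = 0 \<or> sgn n = s")
  case True
  then have "nat \<bar>s + n\<bar> = Suc (nat \<bar>n\<bar>)" "sgn (s + n) = s"
    using assms by (auto simp: sgn_if split: if_splits)
  then show ?thesis using True by (auto simp: marks_def)
next
  case False
  then have "nat \<bar>n\<bar> = Suc (nat \<bar>s + n\<bar>)" "sgn n = - s" "s + n = 0 \<or> sgn (s + n) = - s"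
    using assms by (auto simp: sgn_if split: if_splits)
  then show ?thesis by (auto simp: marks_def)
qed

text \<open>The list is normalised from its right end. The prefix \<open>u\<close> is general so
  that the induction hypothesis can treat \<open>u @ [s]\<close> as the untouched part.\<close>

lemma reduce_slot:
  fixes D :: "nat gauss"
  assumes gauss: "gauss_diagram D" and t: "t \<in> slots D"
  shows "signs D (M(t := u @ v)) \<Longrightarrow>
    decorated_equiv D (M(t := u @ v)) D (M(t := u @ marks (sum_list v)))"
proof (induction v arbitrary: u)
  case Nil
  then show ?case by (simp add: decorated_equiv_refl[OF gauss])
next
  case (Cons s v)
  have s: "s \<in> {1, -1}" and v: "set v \<subseteq> {1, -1}" and u: "set u \<subseteq> {1, -1}"
    using Cons.prems t by (force simp: signs_def)+
  have sg: "signs D (M(t := x))" if "set x \<subseteq> {1, -1}" for x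
    using Cons.prems that unfolding signs_def by (metis fun_upd_apply)
  have 1: "decorated_equiv D (M(t := u @ s # v)) D (M(t := u @ s # marks (sum_list v)))"
    using Cons.IH[of "u @ [s]", unfolded append_assoc append_Cons append_Nil] Cons.prems .
  have "decorated_equiv D (M(t := u @ s # v)) D (M(t := u @ marks (s + sum_list v)))"
  proof (cases "s # marks (sum_list v) = marks (s + sum_list v)")
    case True
    then show ?thesis using 1 by simp
  next
    case False
    then have m: "marks (sum_list v) = - s # marks (s + sum_list v)"
      using Cons_marks[OF s] by blast
    have "signs D (M(t := u @ [s, -s] @ marks (s + sum_list v)))"
      using s u set_marks by (intro sg) auto
    from decorated_equiv_trans[OF 1[unfolded m] _ this[simplified]] cancel_pair[OF gauss this t]
    show ?thesis by simp
  qed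
  then show ?case unfolding sum_list.Cons .
qed

text \<open>Both decorations are brought to the same normal form, one slot at a time;
  \<open>?N S\<close> is the stage at which exactly the slots in \<open>S\<close> are
  normalised.\<close>

lemma same_sums_equiv:
  fixes D :: "nat gauss"
  assumes gauss: "gauss_diagram D" and M: "signs D M" "signs D M'"
    and sum: "\<And>t. t \<in> slots D \<Longrightarrow> sum_list (M t) = sum_list (M' t)"
  shows "decorated_equiv D M D M'"
proof -
  have reduce: "decorated_equiv D N D (\<lambda>t. marks (sum_list (N t)))" if N: "signs D N" for N
  proof -
    let ?N = "\<lambda>S t. if t \<in> S then marks (sum_list (N t)) else N t"
    have sg: "signs D (?N S)" for S
      using N set_marks by (auto simp: signs_def)
    have "finite (slots D)" by (simp add: slots_def points_def)
    moreover have "S \<subseteq> slots D \<Longrightarrow> decorated_equiv D N D (?N S)" if "finite S" for S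
      using that
    proof (induction S rule: finite_induct)
      case empty
      then show ?case by (simp add: decorated_equiv_refl[OF gauss])
    next
      case (insert t S)
      have eq: "?N S = (?N S)(t := [] @ N t)" "?N (insert t S) = (?N S)(t := [] @ marks (sum_list (N t)))"
        using insert.hyps by auto
      have "decorated_equiv D (?N S) D (?N (insert t S))"
        using reduce_slot[OF gauss, of t "?N S" "[]" "N t"] insert.prems sg[of S]
        unfolding eq(2) eq(1)[symmetric] by simp
      then show ?case
        using decorated_equiv_trans[OF _ _ sg] insert by blast
    qed
    ultimately have "decorated_equiv D N D (?N (slots D))" by blast
    then show ?thesis
      using decorated_equiv_cong[of D N N D "?N (slots D)" "\<lambda>t. marks (sum_list (N t))"] by simp
  qed
  have "decorated_equiv D M' D (\<lambda>t. marks (sum_list (M t)))"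
    using reduce[OF M(2)] sum
      decorated_equiv_cong[of D M' M' D "\<lambda>t. marks (sum_list (M' t))" "\<lambda>t. marks (sum_list (M t))"]
    by simp
  moreover have "signs D (\<lambda>t. marks (sum_list (M t)))"
    using set_marks by (auto simp: signs_def)
  ultimately show ?thesis
    using decorated_equiv_trans[OF reduce[OF M(1)]] decorated_equiv_sym by blast
qed

section \<open>Pushing marks through an arrow and along an edge\<close>

lemma gauss_circle_unique:
  assumes "gauss_diagram D" "c \<in> set (circles D)" "c' \<in> set (circles D)" "p \<in> set c" "p \<in> set c'"
  shows "c = c'"
  using assms unfolding gauss_diagram_def distinct_concat_iff by blast

text \<open>A third move with \<omega> as top strand, the strand of the foot of \<open>a\<close> as
  middle and the strand of its head as bottom strand. Both marks precede the ends of
  \<open>a\<close>, so \<beta> and \<gamma> are 1, and the second sign condition says that the two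
  marks have equal signs.\<close>

lemma push_omega:
  assumes gauss: "gauss_diagram D" and a: "a \<in> arrows D"
    and M: "M (Foot a, False) = u @ [s]" "M (Head a, False) = v @ [s]" and Z: "realizes Z D M"
  obtains Z' where "Z \<approx> Z'" "realizes Z' D (M((Foot a, False) := u, (Foot a, True) := s # M (Foot a, True),
    (Head a, False) := v, (Head a, True) := s # M (Head a, True)))"
proof -
  obtain w P where R: "realizes_via w P Z D M" using Z by (auto simp: realizes_def)
  have fa: "Foot a \<in> points D" "Head a \<in> points D"
    using a arrow_in_arrows[OF gauss] by auto
  have w: "distinct w" "set w = Foot ` labels D P" and G: "labels D P \<inter> range Given = {}"
    and cs: "circles Z = w # map (\<lambda>c. concat (map (block P) c)) (circles D)"
    and sG: "arrow_sign Z (Given a) = arrow_sign D a"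
    and disj: "\<And>t t'. t \<in> slots D \<Longrightarrow> t' \<in> slots D \<Longrightarrow> t \<noteq> t' \<Longrightarrow> set (P t) \<inter> set (P t') = {}"
    and dP: "\<And>t. t \<in> slots D \<Longrightarrow> distinct (P t)"
    and MP: "\<And>t. t \<in> slots D \<Longrightarrow> map (arrow_sign Z) (P t) = M t"
    and Ms: "\<And>t. t \<in> slots D \<Longrightarrow> set (M t) \<subseteq> {1, -1}"
    using R a unfolding realizes_via_def by blast+
  have "map (arrow_sign Z) (P (Foot a, False)) = u @ [s]" "map (arrow_sign Z) (P (Head a, False)) = v @ [s]"
    using MP fa M by auto
  then obtain U l1 V l2 where U: "P (Foot a, False) = U @ [l1]" "map (arrow_sign Z) U = u" "arrow_sign Z l1 = s"
    and V: "P (Head a, False) = V @ [l2]" "map (arrow_sign Z) V = v" "arrow_sign Z l2 = s"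
    by (auto simp: map_eq_append_conv)
  have l: "l1 \<in> labels D P" "l2 \<in> labels D P"
    unfolding labels_def using U(1) V(1) fa by (metis UN_I in_slots in_set_conv_decomp)+
  have notG: "Given b \<noteq> l1" "Given b \<noteq> l2" for b using l G by auto
  have l1: "l1 \<in> set (P t) \<longleftrightarrow> t = (Foot a, False)" if "t \<in> slots D" for t
    using disj[of "(Foot a, False)" t] U(1) fa that by auto
  have l2: "l2 \<in> set (P t) \<longleftrightarrow> t = (Head a, False)" if "t \<in> slots D" for t
    using disj[of "(Head a, False)" t] V(1) fa that by auto
  have ne: "l1 \<noteq> l2" using l1[of "(Foot a, False)"] l2[of "(Foot a, False)"] fa by auto
  have UV: "l1 \<notin> set U" "l2 \<notin> set V" "distinct U" "distinct V"
    using dP[of "(Foot a, False)"] dP[of "(Head a, False)"] fa U(1) V(1) by auto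
  have GP: "Given b \<notin> set (P t)" if "t \<in> slots D" for b t
    using G that unfolding labels_def by (metis UN_I disjoint_iff rangeI)

  have s: "s \<in> {1, -1}" using Ms[of "(Foot a, False)"] M(1) fa(1) by simp
  have \<epsilon>: "arrow_sign D a \<in> {1, -1}" using gauss a by (simp add: gauss_diagram_def)
  \<comment> \<open>The first sign condition dictates the order of the two feet on the top strand:
    \<open>\<alpha> * s\<close> must be the sign of \<open>a\<close>. The word \<open>w1\<close>
    puts the feet in that order.\<close>
  define \<alpha> where "\<alpha> = s * arrow_sign D a"
  have \<alpha>: "\<alpha> = 1 \<or> \<alpha> = -1" using s \<epsilon> by (auto simp: \<alpha>_def)
  let ?v = "filter (\<lambda>p. p \<notin> {Foot l1, Foot l2}) w"
  define w1 where "w1 = (if \<alpha> = 1 then [Foot l1, Foot l2] else [Foot l2, Foot l1]) @ ?v"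
  have w1: "distinct w1" "set w1 = set w" using w l ne by (auto simp: w1_def)
  obtain Z1 where R1: "realizes_via w1 P Z1 D M" and Z1: "Z \<approx> Z1" and s1: "arrow_sign Z1 = arrow_sign Z"
    using realizes_reorder[OF R gauss w1] by blast
  have c1: "circles Z1 = w1 # map (\<lambda>c. concat (map (block P) c)) (circles D)"
    using R1 by (simp add: realizes_via_def)
  let ?\<sigma> = "Transposition.transpose (Foot l1) (Foot l2) \<circ>
                Transposition.transpose (Head l1) (Foot (Given a)) \<circ>
                Transposition.transpose (Head l2) (Head (Given a))"
  have dist: "distinct [l1, l2, Given a]" using ne notG by auto
  note \<sigma> = triple_transpose[OF dist]
  have in_circle: "\<exists>j1 j2. j1 @ block P p @ j2 \<in> set (circles Z1)" if p: "p \<in> points D" for p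
  proof -
    obtain c where c: "c \<in> set (circles D)" "p \<in> set c" using p by (auto simp: points_def)
    then obtain c1 c2 where "c = c1 @ p # c2" by (meson split_list)
    then have "concat (map (block P) c) = concat (map (block P) c1) @ block P p @ concat (map (block P) c2)"
      by simp
    then show ?thesis using c(1) unfolding c1 by (metis imageI list.set_map list.set_intros(2))
  qed
  have top: "adjacent_in_order Z1 \<alpha> (Foot l1) (Foot l2)"
    using \<alpha> next_to_middle[of "[]" "Foot l1" "Foot l2" ?v Z1]
      next_to_middle[of "[]" "Foot l2" "Foot l1" ?v Z1]
    by (auto simp: adjacent_in_order_def c1 w1_def)
  have middle: "adjacent_in_order Z1 1 (Head l1) (Foot (Given a))"
  proof -
    obtain j1 j2 where "j1 @ block P (Foot a) @ j2 \<in> set (circles Z1)" using in_circle fa by blast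
    then show ?thesis
      using next_to_middle[of "j1 @ map Head U" "Head l1" "Foot (Given a)" _ Z1]
      by (simp add: block_def U(1) adjacent_in_order_def)
  qed
  have bottom: "adjacent_in_order Z1 1 (Head l2) (Head (Given a))"
  proof -
    obtain j1 j2 where "j1 @ block P (Head a) @ j2 \<in> set (circles Z1)" using in_circle fa by blast
    then show ?thesis
      using next_to_middle[of "j1 @ map Head V" "Head l2" "Head (Given a)" _ Z1]
      by (simp add: block_def V(1) adjacent_in_order_def)
  qed
  define Z2 where "Z2 = move_points ?\<sigma> Z1"
  have "\<alpha> * arrow_sign Z1 l2 = 1 * arrow_sign Z1 (Given a)"
    using s \<epsilon> by (auto simp: s1 V sG \<alpha>_def)
  moreover have "1 * arrow_sign Z1 l2 = 1 * arrow_sign Z1 l1" by (simp add: s1 U V)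
  ultimately have "R3_move Z1 Z2"
    unfolding R3_move_def Z2_def using dist top middle bottom by blast
  then have move: "semiwelded_move Z1 Z2" by (simp add: semiwelded_move_def reidemeister_move_def)

  \<comment> \<open>The move exchanges each mark with the end of \<open>a\<close> that follows it,
    so the marks now come immediately after those ends.\<close>
  define P2 where "P2 = P((Foot a, False) := U, (Foot a, True) := l1 # P (Foot a, True),
    (Head a, False) := V, (Head a, True) := l2 # P (Head a, True))"
  have mem: "l \<in> set (P2 t) \<longleftrightarrow> (if l = l1 then t = (Foot a, True) else if l = l2 then t = (Head a, True)
      else l \<in> set (P t))" if "t \<in> slots D" for l t
    using l1[OF that] l2[OF that] UV U(1) V(1) l1[of "(Head a, True)"] l2[of "(Foot a, True)"]
      l1[of "(Head a, False)"] l2[of "(Foot a, False)"] ne fa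
    by (auto simp: P2_def)
  have labs: "labels D P2 = labels D P"
  proof -
    have "l \<in> labels D P2 \<longleftrightarrow> l \<in> labels D P" for l
      unfolding labels_def using l fa mem ne by (cases "l = l1"; cases "l = l2") (auto simp: labels_def)
    then show ?thesis by blast
  qed
  have \<sigma>H: "map ?\<sigma> (map Head xs) = map Head xs" if "l1 \<notin> set xs" "l2 \<notin> set xs" "Given a \<notin> set xs" for xs
    unfolding map_map using that by (intro map_cong refl) (auto intro!: \<sigma>(7)[simplified])
  have block: "map ?\<sigma> (block P p) = block P2 p" if p: "p \<in> points D" for p
  proof -
    have H: "map ?\<sigma> (map Head (P (p, b))) = map Head (P (p, b))"
      if "(p, b) \<noteq> (Foot a, False)" "(p, b) \<noteq> (Head a, False)" for b
      using that p l1[of "(p, b)"] l2[of "(p, b)"] GP[of "(p, b)"] by (intro \<sigma>H) auto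
    have HU: "map ?\<sigma> (map Head U) = map Head U" "map ?\<sigma> (map Head V) = map Head V"
      using UV U(1) V(1) fa l1[of "(Head a, False)"] l2[of "(Foot a, False)"]
        GP[of "(Foot a, False)" a] GP[of "(Head a, False)" a]
      by (intro \<sigma>H; auto)+
    consider "p = Foot a" | "p = Head a" | "p \<noteq> Foot a" "p \<noteq> Head a" by blast
    then show ?thesis
    proof cases
      case 1
      then show ?thesis using HU H[of True] \<sigma>
        by (simp only: block_def P2_def U(1) map_append) (simp del: o_apply map_map)
    next
      case 2
      then show ?thesis using HU H[of True] \<sigma>
        by (simp only: block_def P2_def V(1) map_append) (simp del: o_apply map_map)
    next
      case 3
      have "?\<sigma> (map_endpoint Given p) = map_endpoint Given p"
        using 3 notG by (intro \<sigma>(7)) (cases p; auto)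
      then show ?thesis using H[of True] H[of False] 3
        by (simp add: block_def P2_def del: o_apply map_map)
    qed
  qed
  have blocks: "map ?\<sigma> (concat (map (block P) c)) = concat (map (block P2) c)" if "c \<in> set (circles D)" for c
  proof -
    have "map ?\<sigma> (block P p) = block P2 p" if "p \<in> set c" for p
      using that \<open>c \<in> set (circles D)\<close> by (intro block) (auto simp: points_def)
    then have "map (\<lambda>p. map ?\<sigma> (block P p)) c = map (block P2) c" by (intro map_cong refl)
    then show ?thesis unfolding map_concat map_map comp_def[of "map ?\<sigma>"] by (rule arg_cong)
  qed
  have "realizes_via (map ?\<sigma> w1) P2 Z2 D (\<lambda>t. map (arrow_sign Z) (P2 t))"
    unfolding realizes_via_def
  proof (intro conjI ballI impI)
    show "circles Z2 = map ?\<sigma> w1 # map (\<lambda>c. concat (map (block P2) c)) (circles D)"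
    proof -
      have "map (map ?\<sigma>) (map (\<lambda>c. concat (map (block P) c)) (circles D)) =
          map (\<lambda>c. concat (map (block P2) c)) (circles D)"
        unfolding map_map comp_def[of "map ?\<sigma>"] by (intro map_cong refl blocks)
      then show ?thesis by (simp add: Z2_def move_points_def c1 del: map_map)
    qed
    show "arrow_sign Z2 (Given b) = arrow_sign D b" if "b \<in> arrows D" for b
      using that R by (simp add: Z2_def move_points_def s1 realizes_via_def)
    show "distinct (map ?\<sigma> w1)"
      unfolding distinct_map using w1(1) \<sigma>(8) by (metis inj_onI)
    have "?\<sigma> q \<in> set w1" if q_in: "q \<in> set w1" for q
    proof -
      obtain l where q: "q = Foot l" "l \<in> labels D P" using q_in w1 w by auto
      have "l \<noteq> Given a" using q(2) G by auto
      then have "?\<sigma> q \<in> {Foot l1, Foot l2, q}"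
        using \<sigma>(1,2) \<sigma>(7)[of q] unfolding q(1) by (cases "l = l1"; cases "l = l2") auto
      then show ?thesis using q_in w1 w l by auto
    qed
    then have "?\<sigma> ` set w1 = set w1" using \<sigma>(8) by (metis (no_types, lifting) image_eqI image_subsetI subsetI subset_antisym)
    then show "set (map ?\<sigma> w1) = Foot ` labels D P2" using w1 w labs by simp
    show "labels D P2 \<inter> range Given = {}" using labs G by simp
    fix t assume t: "t \<in> slots D"
    show "distinct (P2 t)"
      using UV dP[OF t] dP[of "(Foot a, True)"] dP[of "(Head a, True)"] fa
        l1[of "(Foot a, True)"] l2[of "(Head a, True)"] by (auto simp: P2_def)
    show "map (arrow_sign Z2) (P2 t) = map (arrow_sign Z) (P2 t)"
      by (simp add: Z2_def move_points_def s1)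
    show "set (map (arrow_sign Z) (P2 t)) \<subseteq> {1, -1}"
    proof
      fix r assume "r \<in> set (map (arrow_sign Z) (P2 t))"
      then obtain l' where "r = arrow_sign Z l'" "l' \<in> set (P2 t)" by auto
      moreover have "set (P2 t) \<subseteq> labels D P" using t labs by (metis UN_upper labels_def)
      ultimately have "r = arrow_sign Z l'" "l' \<in> labels D P" by auto
      then obtain t' where "t' \<in> slots D" "r \<in> set (map (arrow_sign Z) (P t'))" by (auto simp: labels_def)
      then show "r \<in> {1, -1}" using MP Ms by (metis subsetD)
    qed
    show "set (P2 t) \<inter> set (P2 t') = {}" if "t' \<in> slots D" "t \<noteq> t'" for t'
      using mem[OF t] mem[OF that(1)] disj[OF t that] that(2) by (auto split: if_splits)
  qed
  moreover have "map (arrow_sign Z) (P2 t) = (M((Foot a, False) := u, (Foot a, True) := s # M (Foot a, True),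
    (Head a, False) := v, (Head a, True) := s # M (Head a, True))) t" if "t \<in> slots D" for t
    using that MP fa U V by (simp add: P2_def)
  ultimately have R2: "realizes_via (map ?\<sigma> w1) P2 Z2 D (\<lambda>t. map (arrow_sign Z) (P2 t))"
    "realizes Z2 D (M((Foot a, False) := u, (Foot a, True) := s # M (Foot a, True),
    (Head a, False) := v, (Head a, True) := s # M (Head a, True)))"
    using realizes_cong[of D "\<lambda>t. map (arrow_sign Z) (P2 t)"] unfolding realizes_def by metis+
  have "Z1 \<approx> Z2"
    using semiwelded_equiv_step[OF realizes_semiwelded[OF R1 gauss] realizes_semiwelded[OF R2(1) gauss] move] .
  with Z1 have "Z \<approx> Z2" by (rule rtranclp_trans)
  then show thesis using that R2(2) by blast
qed

text \<open>The slots \<open>(p, True)\<close> and \<open>(q, False)\<close> make up one edge, so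
  the transfer alters only the bookkeeping. The cyclic words stay the same; a word is rotated if its
  base point lies on this edge.\<close>

lemma shift_slot:
  assumes gauss: "gauss_diagram D" and pq: "next_to D p q" "p \<noteq> q"
    and M: "M (p, True) = u @ v" and Z: "realizes Z D M"
  obtains Z' where "Z \<approx> Z'" "realizes Z' D (M((p, True) := u, (q, False) := v @ M (q, False)))"
proof -
  obtain w P where R: "realizes_via w P Z D M" using Z by (auto simp: realizes_def)
  obtain i k r where i: "i < length (circles D)" and rot: "rotate k (circles D ! i) = p # q # r"
    using next_toE[OF pq] by blast
  define c0 where "c0 = circles D ! i"
  have c0: "c0 \<in> set (circles D)" using i by (simp add: c0_def)
  have set0: "set c0 = insert p (insert q (set r))"
    using arg_cong[OF rot, of set] by (simp add: c0_def)
  have "distinct c0" using gauss c0 by (simp add: gauss_diagram_def distinct_concat_iff)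
  then have r: "p \<notin> set r" "q \<notin> set r" using rot by (metis c0_def distinct.simps(2) distinct_rotate list.set_intros(2))+
  have pts: "p \<in> points D" "q \<in> points D" using c0 set0 by (auto simp: points_def)
  have w: "distinct w" "set w = Foot ` labels D P" and G: "labels D P \<inter> range Given = {}"
    and cs: "circles Z = w # map (\<lambda>c. concat (map (block P) c)) (circles D)"
    and disj: "\<And>t t'. t \<in> slots D \<Longrightarrow> t' \<in> slots D \<Longrightarrow> t \<noteq> t' \<Longrightarrow> set (P t) \<inter> set (P t') = {}"
    and dP: "\<And>t. t \<in> slots D \<Longrightarrow> distinct (P t)"
    and MP: "\<And>t. t \<in> slots D \<Longrightarrow> map (arrow_sign Z) (P t) = M t"
    and Ms: "\<And>t. t \<in> slots D \<Longrightarrow> set (M t) \<subseteq> {1, -1}"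
    using R unfolding realizes_via_def by blast+
  have "map (arrow_sign Z) (P (p, True)) = u @ v" using MP pts M by auto
  then obtain U V where U: "P (p, True) = U @ V" "map (arrow_sign Z) U = u" "map (arrow_sign Z) V = v"
    by (auto simp: map_eq_append_conv)
  define P2 where "P2 = P((p, True) := U, (q, False) := V @ P (q, False))"
  define M2 where "M2 = M((p, True) := u, (q, False) := v @ M (q, False))"
  define Z2 where "Z2 = Z\<lparr>circles := w # map (\<lambda>c. concat (map (block P2) c)) (circles D)\<rparr>"
  have V: "l \<in> set V \<Longrightarrow> l \<in> set (P t) \<longleftrightarrow> t = (p, True)" if "t \<in> slots D" for t l
    using disj[of "(p, True)" t] U(1) pts that by auto
  have dUV: "distinct U" "distinct V" "set U \<inter> set V = {}" using dP[of "(p, True)"] pts U(1) by auto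
  have mem: "l \<in> set (P2 t) \<longleftrightarrow> (if l \<in> set V then t = (q, False) else l \<in> set (P t))"
    if "t \<in> slots D" for l t
    using V[OF that] dUV U(1) by (auto simp: P2_def)
  have labs: "labels D P2 = labels D P"
  proof -
    have "l \<in> labels D P2 \<longleftrightarrow> l \<in> labels D P" for l
    proof (cases "l \<in> set V")
      case True
      then have "l \<in> set (P2 (q, False))" "l \<in> set (P (p, True))" by (auto simp: P2_def U(1))
      then show ?thesis using pts unfolding labels_def by (metis UN_I in_slots)
    next
      case False
      then show ?thesis using mem by (auto simp: labels_def)
    qed
    then show ?thesis by blast
  qed
  have R2: "realizes_via w P2 Z2 D M2"
    unfolding realizes_via_def
  proof (intro conjI ballI impI)
    show "circles Z2 = w # map (\<lambda>c. concat (map (block P2) c)) (circles D)" by (simp add: Z2_def)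
    show "arrow_sign Z2 (Given a) = arrow_sign D a" if "a \<in> arrows D" for a
      using R that by (simp add: Z2_def realizes_via_def)
    show "distinct w" "set w = Foot ` labels D P2" "labels D P2 \<inter> range Given = {}"
      using w G labs by auto
    fix t assume t: "t \<in> slots D"
    show "distinct (P2 t)"
      using dUV dP[OF t] dP[of "(q, False)"] V[of "(q, False)"] pts pq(2) by (auto simp: P2_def)
    show "map (arrow_sign Z2) (P2 t) = M2 t"
      using MP[OF t] MP[of "(q, False)"] U pts by (simp add: Z2_def P2_def M2_def)
    show "set (M2 t) \<subseteq> {1, -1}"
      using Ms[OF t] Ms[of "(p, True)"] Ms[of "(q, False)"] pts M by (auto simp: M2_def)
    show "set (P2 t) \<inter> set (P2 t') = {}" if "t' \<in> slots D" "t \<noteq> t'" for t'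
      using mem[OF t] mem[OF that(1)] disj[OF t that] that(2) by (auto split: if_splits)
  qed
  have same: "block P2 x = block P x" if "x \<noteq> p" "x \<noteq> q" for x
    using that by (simp add: block_def P2_def)
  have circ: "\<exists>k. concat (map (block P2) c) = rotate k (concat (map (block P) c))"
    if c: "c \<in> set (circles D)" for c
  proof (cases "c = c0")
    case True
    have "map (block P2) r = map (block P) r" using r by (intro map_cong refl same) auto
    then have "concat (map (block P2) (p # q # r)) = concat (map (block P) (p # q # r))"
    proof -
      have "block P2 p @ block P2 q = block P p @ block P q"
        using pq(2) by (simp add: block_def P2_def U(1))
      then show ?thesis
        using \<open>map (block P2) r = map (block P) r\<close>
        by (simp only: list.map concat.simps append_assoc[symmetric])
    qed
    then have "concat (map (block P2) (rotate k c)) = concat (map (block P) (rotate k c))"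
      using rot True by (simp add: c0_def)
    then obtain k1 k2 where "rotate k1 (concat (map (block P2) c)) = rotate k2 (concat (map (block P) c))"
      by (metis rotate_concat_map)
    then obtain k3 where "concat (map (block P2) c) = rotate k3 (rotate k2 (concat (map (block P) c)))"
      by (metis rotate_sym)
    then show ?thesis unfolding rotate_rotate by blast
  next
    case False
    then have "p \<notin> set c" "q \<notin> set c"
      using gauss_circle_unique[OF gauss c c0] set0 by auto
    then have "map (block P2) c = map (block P) c" by (intro map_cong same) auto
    then show ?thesis by (metis rotate0 id_apply)
  qed
  have "same_diagram_via id Z Z2"
    unfolding same_diagram_via_def
  proof (intro conjI exI[of _ id] allI impI)
    show "length (circles Z2) = length (circles Z)" by (simp add: Z2_def cs)
    fix j assume j: "j < length (circles Z)"
    show "\<exists>k. circles Z2 ! id j = rotate k (map (map_endpoint id) (circles Z ! j))"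
    proof (cases j)
      case 0
      then show ?thesis by (intro exI[of _ 0]) (simp add: Z2_def cs endpoint.map_id0)
    next
      case (Suc j')
      then show ?thesis using circ[of "circles D ! j'"] j by (simp add: Z2_def cs endpoint.map_id0)
    qed
  qed (auto simp: permutes_id Z2_def)
  then have "semiwelded_move Z Z2" unfolding semiwelded_move_def by (metis id_apply)
  then have "Z \<approx> Z2"
    by (intro semiwelded_equiv_step realizes_semiwelded[OF R gauss] realizes_semiwelded[OF R2 gauss])
  then show thesis using that R2 unfolding M2_def realizes_def by blast
qed


section \<open>Integer decorations\<close>

abbreviation marked_equiv ::
  "'a gauss \<Rightarrow> ('a slot \<Rightarrow> int) \<Rightarrow> 'a gauss \<Rightarrow> ('a slot \<Rightarrow> int) \<Rightarrow> bool" where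
  "marked_equiv D m D' m' \<equiv> decorated_equiv D (\<lambda>t. marks (m t)) D' (\<lambda>t. marks (m' t))"

lemma signs_marks: "signs D (\<lambda>t. marks (m t))"
  using set_marks by (simp add: signs_def)

lemma marked_equiv_trans [trans]:
  fixes E :: "nat gauss"
  assumes "marked_equiv D m E n" "marked_equiv E n D' m'"
  shows "marked_equiv D m D' m'"
  using decorated_equiv_trans[OF assms signs_marks] .

definition push :: "'a \<Rightarrow> int \<Rightarrow> ('a slot \<Rightarrow> int) \<Rightarrow> 'a slot \<Rightarrow> int" where
  "push a k m = (\<lambda>(p, b). m (p, b) + (if arrow_of p = a then if b then k else - k else 0))"

lemma push_equiv_unit:
  fixes D :: "nat gauss"
  assumes gauss: "gauss_diagram D" and a: "a \<in> arrows D" and s: "s \<in> {1, -1}"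
  shows "marked_equiv D m D (push a s m)"
proof -
  \<comment> \<open>One mark of sign \<open>s\<close> is split off at the end of each slot before an
    end of \<open>a\<close>; the sums do not change, and the pair is ready for the third
    move.\<close>
  define M1 where "M1 = (\<lambda>t. marks (m t))((Foot a, False) := marks (m (Foot a, False) - s) @ [s],
    (Head a, False) := marks (m (Head a, False) - s) @ [s])"
  define M2 where "M2 = M1((Foot a, False) := marks (m (Foot a, False) - s),
    (Foot a, True) := s # M1 (Foot a, True),
    (Head a, False) := marks (m (Head a, False) - s), (Head a, True) := s # M1 (Head a, True))"
  have sg: "signs D M1" "signs D M2"
    using set_marks s by (auto simp: signs_def M1_def M2_def)
  have 1: "decorated_equiv D (\<lambda>t. marks (m t)) D M1"
    by (intro same_sums_equiv[OF gauss signs_marks sg(1)]) (auto simp: M1_def)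
  obtain Z1 where Z1: "realizes Z1 D M1"
    using realization_exists[of D M1] sg(1) by (auto simp: signs_def)
  obtain Z2 where "Z1 \<approx> Z2" "realizes Z2 D M2"
  proof (rule push_omega[OF gauss a _ _ Z1])
    show "M1 (Foot a, False) = marks (m (Foot a, False) - s) @ [s]"
      "M1 (Head a, False) = marks (m (Head a, False) - s) @ [s]"
      by (simp_all add: M1_def)
  qed (auto simp: M2_def)
  then have 2: "decorated_equiv D M1 D M2" using decorated_equivI[OF gauss gauss Z1] by blast
  have 3: "decorated_equiv D M2 D (\<lambda>t. marks (push a s m t))"
  proof (intro same_sums_equiv[OF gauss sg(2) signs_marks])
    fix t :: "nat slot"
    show "sum_list (M2 t) = sum_list (marks (push a s m t))"
      by (cases t; cases "fst t") (auto simp: M1_def M2_def push_def)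
  qed
  show ?thesis
    using decorated_equiv_trans[OF decorated_equiv_trans[OF 1 2 sg(1)] 3 sg(2)] .
qed

text \<open>Unit pushes are iterated. Pushing marks of sign -1 forward has the effect of pulling
  marks of sign 1 backward, so the forward third move covers negative \<open>k\<close> as
  well.\<close>

lemma push_equiv:
  fixes D :: "nat gauss"
  assumes gauss: "gauss_diagram D" and a: "a \<in> arrows D"
  shows "marked_equiv D m D (push a k m)"
proof -
  have *: "marked_equiv D m D (push a (s * int n) m)" if s: "s \<in> {1, -1}" for s n
  proof (induction n)
    case 0
    have "push a (s * int 0) m = m" by (auto simp: push_def)
    then show ?case by (simp add: decorated_equiv_refl[OF gauss])
  next
    case (Suc n)
    have "push a s (push a (s * int n) m) = push a (s * int (Suc n)) m"
      by (auto simp: push_def algebra_simps)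
    then show ?case
      using marked_equiv_trans[OF Suc push_equiv_unit[OF gauss a s]] by simp
  qed
  \<comment> \<open>\<open>sgn k\<close> is a legitimate sign unless \<open>k = 0\<close>; that case
    is the instance with \<open>s = 1\<close> and \<open>n = 0\<close>.\<close>
  have "k = sgn k * int (nat \<bar>k\<bar>)" by (simp add: sgn_mult_abs)
  then show ?thesis
    using *[of "sgn k" "nat \<bar>k\<bar>"] *[of 1 0] by (cases "k = 0") (auto simp: sgn_if split: if_splits)
qed

text \<open>The two halves of the edge joining \<open>p\<close> and \<open>q\<close>, oriented as
  recorded by \<delta>.\<close>

definition gap :: "int \<Rightarrow> 'a endpoint \<Rightarrow> 'a endpoint \<Rightarrow> 'a slot set" where
  "gap \<delta> p q = (if \<delta> = 1 then {(p, True), (q, False)} else {(q, True), (p, False)})"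

definition clear :: "'a slot set \<Rightarrow> ('a slot \<Rightarrow> int) \<Rightarrow> 'a slot \<Rightarrow> int" where
  "clear S m = (\<lambda>t. if t \<in> S then 0 else m t)"

text \<open>All marks of the edge are collected in its second half, where they cancel because their
  total is zero.\<close>

lemma clear_gap_equiv:
  fixes D :: "nat gauss"
  assumes gauss: "gauss_diagram D" and adj: "adjacent_in_order D \<delta> p q" and pq: "p \<noteq> q"
    and sum: "sum m (gap \<delta> p q) = 0"
  shows "marked_equiv D m D (clear (gap \<delta> p q) m)"
proof -
  have *: "marked_equiv D m D (clear {(p, True), (q, False)} m)"
    if pq: "next_to D p q" "p \<noteq> q" "m (p, True) + m (q, False) = 0" for p q
  proof -
    let ?M = "\<lambda>t. marks (m t)"
    let ?M2 = "?M((p, True) := [], (q, False) := marks (m (p, True)) @ marks (m (q, False)))"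
    obtain Z where Z: "realizes Z D ?M"
      using realization_exists[of D ?M] set_marks by blast
    obtain Z' where "Z \<approx> Z'" "realizes Z' D ?M2"
      using shift_slot[OF gauss pq(1,2) _ Z, of "[]" "marks (m (p, True))"] by auto
    then have 1: "decorated_equiv D ?M D ?M2"
      using decorated_equivI[OF gauss gauss Z] by blast
    have sg: "signs D ?M2" using set_marks by (auto simp: signs_def)
    have "decorated_equiv D ?M2 D (\<lambda>t. marks (clear {(p, True), (q, False)} m t))"
      using pq(3) by (intro same_sums_equiv[OF gauss sg signs_marks]) (auto simp: clear_def)
    then show ?thesis using decorated_equiv_trans[OF 1 _ sg] by blast
  qed
  consider "\<delta> = 1" "next_to D p q" | "\<delta> = -1" "next_to D q p"
    using adj by (auto simp: adjacent_in_order_def)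
  then show ?thesis
    using *[of p q] *[of q p] pq sum by cases (simp_all add: gap_def)
qed



section \<open>Lifting the moves\<close>

text \<open>Once the edge between them carries no marks, neighbouring ends of \<open>D\<close> are
  neighbours in the realization too, so a move of \<open>D\<close> can be performed there.\<close>

lemma next_to_realization:
  assumes R: "realizes_via w P Z D M" and pq: "next_to D p q" "p \<noteq> q"
    and M: "P (p, True) = []" "P (q, False) = []"
  shows "next_to Z (map_endpoint Given p) (map_endpoint Given q)"
proof -
  obtain i k r where i: "i < length (circles D)" and rot: "rotate k (circles D ! i) = p # q # r"
    using next_toE[OF pq] by blast
  let ?c = "concat (map (block P) (circles D ! i))"
  have c: "?c \<in> set (circles Z)" using R i unfolding realizes_via_def by auto
  obtain k' where k': "concat (map (block P) (p # q # r)) = rotate k' ?c"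
    unfolding rot[symmetric] using rotate_concat_map by blast
  then have "rotate (length (map Head (P (p, False)))) (rotate k' ?c) =
     map_endpoint Given p # map_endpoint Given q # (map Head (P (q, True)) @ concat (map (block P) r)) @
     map Head (P (p, False))"
    using rotate_append[of "map Head (P (p, False))"]
    unfolding k'[symmetric] by (simp add: block_def M)
  then show ?thesis using next_toI[OF c] unfolding rotate_rotate by blast
qed

lemma empty_labels:
  assumes "realizes_via w P Z D M" "t \<in> slots D"
  shows "P t = [] \<longleftrightarrow> M t = []"
  using assms unfolding realizes_via_def by (metis map_is_Nil_conv)

lemma points_remove: "points (remove_arrows A D) = {p \<in> points D. arrow_of p \<notin> A}"
  by (auto simp: points_def remove_arrows_def)

lemma realizes_remove_given:
  assumes R: "realizes_via w P Z D M"
    and M: "\<And>p b. p \<in> points D \<Longrightarrow> arrow_of p \<in> A \<Longrightarrow> M (p, b) = []"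
  shows "realizes (remove_arrows (Given ` A) Z) (remove_arrows A D) M"
proof -
  let ?D = "remove_arrows A D"
  have G: "labels D P \<inter> range Given = {}" using R by (simp add: realizes_via_def)
  have A: "{a. Given a \<in> Given ` A} = A" by auto
  have "l \<in> Given ` A" if "p \<in> points D" "Given (arrow_of p) \<in> Given ` A" "l \<in> set (P (p, b))" for p b l
    using empty_labels[OF R, of "(p, b)"] M that by auto
  then have "realizes (remove_arrows (Given ` A) Z) ?D
     (\<lambda>t. map (arrow_sign Z) (filter (\<lambda>l. l \<notin> Given ` A) (P t)))"
    using realizes_remove[OF R, of "Given ` A"] unfolding A realizes_def by blast
  moreover have "map (arrow_sign Z) (filter (\<lambda>l. l \<notin> Given ` A) (P t)) = M t" if t: "t \<in> slots ?D" for t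
  proof -
    have t': "t \<in> slots D" using t by (auto simp: slots_def points_remove)
    then have "filter (\<lambda>l. l \<notin> Given ` A) (P t) = P t"
      using G unfolding labels_def filter_id_conv by blast
    then show ?thesis using R t' by (simp add: realizes_via_def)
  qed
  ultimately show ?thesis
    using realizes_cong[of ?D "\<lambda>t. map (arrow_sign Z) (filter (\<lambda>l. l \<notin> Given ` A) (P t))" M] by simp
qed

text \<open>When all slots at the removed arrows are empty, the removal strands no marks; what
  remains realizes the same function \<open>m\<close> on the smaller set of slots.\<close>

lemma remove_given_equiv:
  fixes D :: "nat gauss"
  assumes gauss: "gauss_diagram D"
    and m: "\<And>p b. p \<in> points D \<Longrightarrow> arrow_of p \<in> A \<Longrightarrow> m (p, b) = 0"
    and move: "\<And>w P Z. realizes_via w P Z D (\<lambda>t. marks (m t)) \<Longrightarrow>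
      reidemeister_move Z (remove_arrows (Given ` A) Z)"
  shows "marked_equiv D m (remove_arrows A D) m"
proof -
  let ?D = "remove_arrows A D"
  obtain Z where "realizes Z D (\<lambda>t. marks (m t))"
    using realization_exists[of D "\<lambda>t. marks (m t)"] set_marks by blast
  then obtain w P where R: "realizes_via w P Z D (\<lambda>t. marks (m t))" by (auto simp: realizes_def)
  let ?Z = "remove_arrows (Given ` A) Z"
  have gauss': "gauss_diagram ?D" using gauss_diagram_remove[OF gauss] .
  have R': "realizes ?Z ?D (\<lambda>t. marks (m t))"
    using realizes_remove_given[OF R] m by simp
  have "semiwelded_diagram ?Z" using R' realizes_semiwelded gauss' by (auto simp: realizes_def)
  then have "Z \<approx> ?Z"
    using realizes_semiwelded[OF R gauss] move[OF R]
    by (intro semiwelded_equiv_step) (auto simp: semiwelded_move_def)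
  then show ?thesis
    using decorated_equivI[OF gauss gauss' _ R'] R by (auto simp: realizes_def)
qed

definition zh_marks :: "'a gauss \<Rightarrow> 'a slot \<Rightarrow> int" where
  "zh_marks D = (\<lambda>(p, b). case p of
     Foot a \<Rightarrow> if b then 0 else - arrow_sign D a
   | Head a \<Rightarrow> if b then arrow_sign D a else 0)"

lemma next_to_points: "next_to D p q \<Longrightarrow> p \<in> points D \<and> q \<in> points D"
  unfolding next_to_def points_def by (auto simp: in_set_conv_nth)
    (metis length_greater_0_conv length_pos_if_in_set mod_less_divisor nth_mem)+

lemma adjacent_points:
  "adjacent_in_order D \<delta> p q \<Longrightarrow> p \<in> points D \<and> q \<in> points D"
  "adjacent D p q \<Longrightarrow> p \<in> points D \<and> q \<in> points D"
  using next_to_points by (auto simp: adjacent_in_order_def adjacent_def)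

lemma arrow_sign_remove [simp]: "arrow_sign (remove_arrows A D) = arrow_sign D"
  by (simp add: remove_arrows_def)

lemma zh_marks_remove: "zh_marks (remove_arrows A D) = zh_marks D"
  unfolding zh_marks_def arrow_sign_remove by (rule refl)

text \<open>\<open>zh_marks\<close> depends on the sign function alone, which removal preserves, so
  it is enough to compare with the old decoration at the surviving ends.\<close>

lemma zh_marks_cong:
  assumes "gauss_diagram D" "\<And>p b. arrow_of p \<notin> A \<Longrightarrow> m (p, b) = zh_marks D (p, b)"
  shows "marked_equiv (remove_arrows A D) m (remove_arrows A D) (zh_marks (remove_arrows A D))"
proof -
  let ?D = "remove_arrows A D"
  have "marks (m t) = marks (zh_marks ?D t)" if "t \<in> slots ?D" for t
    using that assms(2) by (cases t) (auto simp: zh_marks_remove points_remove)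
  then show ?thesis
    using decorated_equiv_cong[of ?D "\<lambda>t. marks (m t)" "\<lambda>t. marks (zh_marks ?D t)" ?D
        "\<lambda>t. marks (zh_marks ?D t)" "\<lambda>t. marks (zh_marks ?D t)"]
      decorated_equiv_refl[OF gauss_diagram_remove[OF assms(1)], of A] by simp
qed

section \<open>First Reidemeister move\<close>

text \<open>If the head comes first, both marks of \<open>Zh\<close> lie on the edge between the
  ends and cancel. If the foot comes first, they lie outside that edge, and a push by the negative
  of the sign brings them onto it.\<close>

lemma R1_lift:
  fixes D :: "nat gauss"
  assumes gauss: "gauss_diagram D" and R1: "R1_removal D D'"
  shows "marked_equiv D (zh_marks D) D' (zh_marks D')"
proof -
  obtain a where adj: "adjacent D (Foot a) (Head a)" and D': "D' = remove_arrows {a} D"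
    using R1 by (auto simp: R1_removal_def)
  have a: "a \<in> arrows D" using adjacent_points(2)[OF adj] by (force simp: arrows_def)
  let ?e = "arrow_sign D a"
  have remove: "marked_equiv D m D' m" if m: "\<And>b. m (Foot a, b) = 0" "\<And>b. m (Head a, b) = 0" for m
    unfolding D'
  proof (rule remove_given_equiv[OF gauss])
    show "m (p, b) = 0" if "arrow_of p \<in> {a}" for p b using m that by (cases p) auto
    fix w P Z assume R: "realizes_via w P Z D (\<lambda>t. marks (m t))"
    have "P (Foot a, b) = []" "P (Head a, b) = []" for b
      using empty_labels[OF R] adjacent_points(2)[OF adj] m by auto
    then have "adjacent Z (Foot (Given a)) (Head (Given a))"
      using adj next_to_realization[OF R, of "Foot a" "Head a"] next_to_realization[OF R, of "Head a" "Foot a"]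
      by (auto simp: adjacent_def)
    then show "reidemeister_move Z (remove_arrows (Given ` {a}) Z)"
      by (auto simp: reidemeister_move_def R1_removal_def)
  qed
  have cong: "marked_equiv D' m D' (zh_marks D')"
    if "\<And>p b. arrow_of p \<notin> {a} \<Longrightarrow> m (p, b) = zh_marks D (p, b)" for m
    unfolding D' using that by (rule zh_marks_cong[OF gauss])
  from adj consider "next_to D (Foot a) (Head a)" | "next_to D (Head a) (Foot a)"
    by (auto simp: adjacent_def)
  then show ?thesis
  proof cases
    case 1
    let ?m = "push a (- ?e) (zh_marks D)"
    let ?g = "gap 1 (Foot a) (Head a)"
    have "marked_equiv D (zh_marks D) D ?m" by (rule push_equiv[OF gauss a])
    also have "marked_equiv D ?m D (clear ?g ?m)"
      using 1 by (intro clear_gap_equiv[OF gauss])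
        (auto simp: adjacent_in_order_def gap_def push_def zh_marks_def)
    also have "marked_equiv D (clear ?g ?m) D' (clear ?g ?m)"
      by (rule remove) (auto simp: clear_def gap_def push_def zh_marks_def)
    also have "marked_equiv D' (clear ?g ?m) D' (zh_marks D')"
      by (rule cong) (auto simp: clear_def gap_def push_def)
    finally show ?thesis .
  next
    case 2
    let ?g = "gap 1 (Head a) (Foot a)"
    have "marked_equiv D (zh_marks D) D (clear ?g (zh_marks D))"
      using 2 by (intro clear_gap_equiv[OF gauss])
        (auto simp: adjacent_in_order_def gap_def zh_marks_def)
    also have "marked_equiv D (clear ?g (zh_marks D)) D' (clear ?g (zh_marks D))"
      by (rule remove) (auto simp: clear_def gap_def zh_marks_def)
    also have "marked_equiv D' (clear ?g (zh_marks D)) D' (zh_marks D')"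
      by (rule cong) (auto simp: clear_def gap_def)
    finally show ?thesis .
  qed
qed

section \<open>Second Reidemeister move\<close>

lemma remove_arrows_remove_arrows: "remove_arrows A (remove_arrows B D) = remove_arrows (A \<union> B) D"
  by (simp add: remove_arrows_def comp_def conj_commute)

text \<open>The marks \<open>e\<close> before \<open>Head a\<close> and \<open>- e\<close> after
  \<open>Head b\<close> lie on the two sides of the bigon. Removing the bigon makes them neighbours,
  and a second bigon, with \<omega> as upper strand, removes them.\<close>

lemma remove_parallel_bigon:
  fixes D :: "nat gauss"
  assumes gauss: "gauss_diagram D" and ab: "a \<noteq> b" "next_to D (Foot a) (Foot b)" "next_to D (Head a) (Head b)"
    and sgn: "arrow_sign D a = - arrow_sign D b"
    and m: "\<And>i. m (Foot a, i) = 0" "\<And>i. m (Foot b, i) = 0" "m (Head a, True) = 0" "m (Head b, False) = 0"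
      "m (Head a, False) = e" "m (Head b, True) = - e" and e: "e \<in> {1, -1}"
  shows "marked_equiv D m (remove_arrows {a, b} D) m"
proof -
  let ?M = "\<lambda>t. marks (m t)"
  let ?D = "remove_arrows {a, b} D"
  obtain Z where "realizes Z D ?M"
    using realization_exists[of D ?M] set_marks by blast
  then obtain w P where R: "realizes_via w P Z D ?M" by (auto simp: realizes_def)
  have pts: "Foot a \<in> points D" "Foot b \<in> points D" "Head a \<in> points D" "Head b \<in> points D"
    using ab next_to_points by blast+
  have w: "distinct w" "set w = Foot ` labels D P" and G: "labels D P \<inter> range Given = {}"
    and MP: "\<And>t. t \<in> slots D \<Longrightarrow> map (arrow_sign Z) (P t) = ?M t"
    and disj: "\<And>t t'. t \<in> slots D \<Longrightarrow> t' \<in> slots D \<Longrightarrow> t \<noteq> t' \<Longrightarrow> set (P t) \<inter> set (P t') = {}"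
    using R unfolding realizes_via_def by blast+
  have empty: "P (Foot a, i) = []" "P (Foot b, i) = []" "P (Head a, True) = []" "P (Head b, False) = []" for i
    using empty_labels[OF R] pts m by auto
  have "map (arrow_sign Z) (P (Head a, False)) = [e]" "map (arrow_sign Z) (P (Head b, True)) = [- e]"
    using MP pts m e by auto
  then obtain l1 l2 where l1: "P (Head a, False) = [l1]" "arrow_sign Z l1 = e"
    and l2: "P (Head b, True) = [l2]" "arrow_sign Z l2 = - e"
    by auto
  have l: "l1 \<in> labels D P" "l2 \<in> labels D P"
    unfolding labels_def using l1(1) l2(1) pts by (metis UN_I in_slots list.set_intros(1))+
  have notG: "Given c \<noteq> l1" "Given c \<noteq> l2" "l1 \<noteq> Given c" "l2 \<noteq> Given c" for c
    using l G by auto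
  have ne: "l1 \<noteq> l2" using l1 l2 e by auto
  \<comment> \<open>The feet of the two marks are put side by side beforehand, so that the second
    bigon is present as soon as the first one is gone.\<close>
  let ?v = "filter (\<lambda>p. p \<notin> {Foot l1, Foot l2}) w"
  let ?w = "Foot l1 # Foot l2 # ?v"
  have "distinct ?w" "set ?w = set w" using w l ne by auto
  then obtain Z1 where R1: "realizes_via ?w P Z1 D ?M" and s1: "arrow_sign Z1 = arrow_sign Z"
    using realizes_reorder[OF R gauss] by blast
  have c1: "circles Z1 = ?w # map (\<lambda>c. concat (map (block P) c)) (circles D)"
    and sG: "\<And>c. c \<in> arrows D \<Longrightarrow> arrow_sign Z1 (Given c) = arrow_sign D c"
    using R1 by (simp_all add: realizes_via_def)
  define Z2 where "Z2 = remove_arrows {Given a, Given b} Z1"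
  define Z3 where "Z3 = remove_arrows {l1, l2} Z2"
  have "next_to Z1 (Foot (Given a)) (Foot (Given b))" "next_to Z1 (Head (Given a)) (Head (Given b))"
    using next_to_realization[OF R1 ab(2)] next_to_realization[OF R1 ab(3)] empty ab(1) by auto
  moreover have "arrow_sign Z1 (Given a) = - arrow_sign Z1 (Given b)"
    using sG sgn pts arrow_in_arrows[OF gauss] by simp
  ultimately have "R2_removal Z1 Z2"
    unfolding R2_removal_def Z2_def adjacent_def using ab(1)
    by (intro exI[of _ "Given a"] exI[of _ "Given b"]) auto
  then have move1: "semiwelded_move Z1 Z2" by (simp add: semiwelded_move_def reidemeister_move_def)

  have "next_to Z2 (Foot l1) (Foot l2)"
    using next_to_middle[of "[]" "Foot l1" "Foot l2" "filter (\<lambda>p. arrow_of p \<notin> {Given a, Given b}) ?v" Z2]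
      notG by (simp add: Z2_def remove_arrows_def c1)
  moreover have "next_to Z2 (Head l1) (Head l2)"
  proof -
    let ?f = "filter (\<lambda>p. arrow_of p \<notin> {Given a, Given b})"
    have "Head a \<noteq> Head b" using ab(1) by simp
    then obtain i k r where i: "i < length (circles D)"
      and rot: "rotate k (circles D ! i) = Head a # Head b # r"
      using next_toE[OF ab(3)] by blast
    let ?c = "concat (map (block P) (circles D ! i))"
    have "?f ?c \<in> set (circles Z2)" using i by (simp add: Z2_def remove_arrows_def c1)
    moreover obtain k' where k': "concat (map (block P) (Head a # Head b # r)) = rotate k' ?c"
      unfolding rot[symmetric] using rotate_concat_map by blast
    obtain k'' where k'': "?f (rotate k' ?c) = rotate k'' (?f ?c)" using rotate_filter by blast
    have "?f (concat (map (block P) (Head a # Head b # r))) =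
        Head l1 # Head l2 # ?f (concat (map (block P) r))"
      using notG by (auto simp: block_def empty l1 l2)
    then have "rotate k'' (?f ?c) = Head l1 # Head l2 # ?f (concat (map (block P) r))"
      unfolding k' k'' .
    ultimately show ?thesis by (rule next_toI)
  qed
  moreover have "arrow_sign Z2 l1 = - arrow_sign Z2 l2" by (simp add: Z2_def s1 l1 l2)
  ultimately have "R2_removal Z2 Z3"
    unfolding R2_removal_def Z3_def adjacent_def using ne
    by (intro exI[of _ l1] exI[of _ l2]) auto
  then have move2: "semiwelded_move Z2 Z3" by (simp add: semiwelded_move_def reidemeister_move_def)

  have gauss': "gauss_diagram ?D" using gauss_diagram_remove[OF gauss] .
  let ?L = "{l1, l2, Given a, Given b}"
  \<comment> \<open>Both removals are evaluated at once: in \<open>Z2\<close> the marks are left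
    over from slots whose ends have just been deleted, so only \<open>Z3\<close> is compared with a
    decoration of the smaller diagram.\<close>
  have Z3: "Z3 = remove_arrows ?L Z1"
    unfolding Z3_def Z2_def remove_arrows_remove_arrows by (simp add: insert_commute)
  have "{c. Given c \<in> ?L} = {a, b}" using notG by auto
  moreover have "x \<in> ?L" if "p \<in> points D" "Given (arrow_of p) \<in> ?L" "x \<in> set (P (p, i))" for p i x
    using that notG empty l1(1) l2(1) by (cases p; cases i) auto
  ultimately have R3: "realizes Z3 ?D (\<lambda>t. map (arrow_sign Z1) (filter (\<lambda>l. l \<notin> ?L) (P t)))"
    using realizes_remove[OF R1, of ?L] unfolding Z3 realizes_def by metis
  have "map (arrow_sign Z1) (filter (\<lambda>l. l \<notin> ?L) (P t)) = ?M t" if t: "t \<in> slots ?D" for t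
  proof -
    have t': "t \<in> slots D" "arrow_of (fst t) \<notin> {a, b}" using t by (auto simp: slots_def points_remove)
    then have "t \<noteq> (Head a, False)" "t \<noteq> (Head b, True)" by auto
    then have "l1 \<notin> set (P t)" "l2 \<notin> set (P t)"
      using disj[of t "(Head a, False)"] disj[of t "(Head b, True)"] l1 l2 pts t'(1) by auto
    moreover have "Given c \<notin> set (P t)" for c using G t'(1) unfolding labels_def by blast
    ultimately have "filter (\<lambda>l. l \<notin> ?L) (P t) = P t" unfolding filter_id_conv by blast
    then show ?thesis using MP[OF t'(1)] by (simp add: s1)
  qed
  then have R3': "realizes Z3 ?D ?M"
    using R3 realizes_cong[of ?D "\<lambda>t. map (arrow_sign Z1) (filter (\<lambda>l. l \<notin> ?L) (P t))" ?M] by simp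
  have sw1: "semiwelded_diagram Z1" using realizes_semiwelded[OF R1 gauss] .
  have sw3: "semiwelded_diagram Z3" using R3' realizes_semiwelded gauss' by (auto simp: realizes_def)
  have sw2: "semiwelded_diagram Z2"
    using sw1 gauss_diagram_remove[of Z1 "{Given a, Given b}"]
    by (simp add: Z2_def semiwelded_diagram_def) (simp add: remove_arrows_def)
  have "Z1 \<approx> Z3"
    using semiwelded_equiv_step[OF sw1 sw2 move1] semiwelded_equiv_step[OF sw2 sw3 move2]
    by (rule rtranclp_trans)
  then show ?thesis
    using decorated_equivI[OF gauss gauss' _ R3'] R1 by (auto simp: realizes_def)
qed

text \<open>One push empties all slots at the feet and leaves \<open>?e\<close> before
  \<open>Head a\<close> and its negative after \<open>Head b\<close>. With antiparallel strands
  these two share the edge between the heads and cancel there; with parallel strands they lie on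
  opposite sides of the bigon.\<close>

lemma R2_lift_ordered:
  fixes D :: "nat gauss"
  assumes gauss: "gauss_diagram D" and ab: "a \<noteq> b" "next_to D (Foot a) (Foot b)" "adjacent D (Head a) (Head b)"
    and sgn: "arrow_sign D a = - arrow_sign D b"
  defines "D' \<equiv> remove_arrows {a, b} D"
  shows "marked_equiv D (zh_marks D) D' (zh_marks D')"
proof -
  have a: "a \<in> arrows D"
    using next_to_points[OF ab(2)] arrow_in_arrows(1)[OF gauss] by blast
  let ?e = "arrow_sign D a"
  have e: "?e \<in> {1, -1}" using gauss a by (simp add: gauss_diagram_def)
  have sb: "arrow_sign D b = - ?e" using sgn by simp
  let ?g = "gap 1 (Foot a) (Foot b)"
  \<comment> \<open>The push removes the mark before \<open>Foot a\<close> and puts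
    \<open>- ?e\<close> after it, which cancels the mark \<open>?e\<close> before
    \<open>Foot b\<close>.\<close>
  define m where "m = clear ?g (push a (- ?e) (zh_marks D))"
  have m: "m (Foot a, i) = 0" "m (Foot b, i) = 0" "m (Head a, True) = 0" "m (Head b, False) = 0"
      "m (Head a, False) = ?e" "m (Head b, True) = - ?e" for i
    using ab(1) sb by (auto simp: m_def clear_def gap_def push_def zh_marks_def)
  have m': "m (p, i) = zh_marks D (p, i)" if "arrow_of p \<notin> {a, b}" for p i
    using that by (auto simp: m_def clear_def gap_def push_def)
  have "marked_equiv D (zh_marks D) D (push a (- ?e) (zh_marks D))" by (rule push_equiv[OF gauss a])
  also have "marked_equiv D (push a (- ?e) (zh_marks D)) D m"
    unfolding m_def using ab sb
    by (intro clear_gap_equiv[OF gauss]) (auto simp: adjacent_in_order_def gap_def push_def zh_marks_def)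
  finally have 1: "marked_equiv D (zh_marks D) D m" .
  from ab(3) consider "next_to D (Head a) (Head b)" | "next_to D (Head b) (Head a)"
    by (auto simp: adjacent_def)
  then show ?thesis
  proof cases
    case 1
    note \<open>marked_equiv D (zh_marks D) D m\<close>
    also have "marked_equiv D m D' m"
      unfolding D'_def using remove_parallel_bigon[OF gauss ab(1,2) 1 sgn m e] .
    also have "marked_equiv D' m D' (zh_marks D')"
      unfolding D'_def using m' by (rule zh_marks_cong[OF gauss])
    finally show ?thesis .
  next
    case 2
    let ?h = "gap 1 (Head b) (Head a)"
    note 1
    also have "marked_equiv D m D (clear ?h m)"
      using 2 ab(1) m by (intro clear_gap_equiv[OF gauss]) (auto simp: adjacent_in_order_def gap_def)
    also have "marked_equiv D (clear ?h m) D' (clear ?h m)"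
      unfolding D'_def
    proof (rule remove_given_equiv[OF gauss])
      fix p i assume "arrow_of p \<in> {a, b}"
      then show z: "clear ?h m (p, i) = 0"
        using m by (cases p; cases i) (auto simp: clear_def gap_def)
    next
      fix w P Z assume R: "realizes_via w P Z D (\<lambda>t. marks (clear ?h m t))"
      have "P (p, i) = []" if "p \<in> {Foot a, Foot b, Head a, Head b}" for p i
        using that empty_labels[OF R, of "(p, i)"] next_to_points[OF ab(2)] adjacent_points(2)[OF ab(3)] m
        by (cases i) (auto simp: clear_def gap_def)
      then have "next_to Z (Foot (Given a)) (Foot (Given b))" "next_to Z (Head (Given b)) (Head (Given a))"
        using next_to_realization[OF R ab(2)] next_to_realization[OF R 2] ab(1) by auto
      moreover have "arrow_sign Z (Given a) = - arrow_sign Z (Given b)"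
        using R sgn a next_to_points[OF ab(2)] arrow_in_arrows(1)[OF gauss]
        by (auto simp: realizes_via_def)
      ultimately have "R2_removal Z (remove_arrows {Given a, Given b} Z)"
        unfolding R2_removal_def adjacent_def using ab(1) by blast
      then show "reidemeister_move Z (remove_arrows (Given ` {a, b}) Z)"
        by (simp add: reidemeister_move_def)
    qed
    also have "marked_equiv D' (clear ?h m) D' (zh_marks D')"
      unfolding D'_def using m' by (intro zh_marks_cong[OF gauss]) (auto simp: clear_def gap_def)
    finally show ?thesis .
  qed
qed

lemma R2_lift:
  fixes D :: "nat gauss"
  assumes gauss: "gauss_diagram D" and R2: "R2_removal D D'"
  shows "marked_equiv D (zh_marks D) D' (zh_marks D')"
proof -
  obtain a b where ab: "a \<noteq> b" "adjacent D (Foot a) (Foot b)" "adjacent D (Head a) (Head b)"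
      "arrow_sign D a = - arrow_sign D b" and D': "D' = remove_arrows {a, b} D"
    using R2 by (auto simp: R2_removal_def)
  from ab(2) consider "next_to D (Foot a) (Foot b)" | "next_to D (Foot b) (Foot a)"
    by (auto simp: adjacent_def)
  then show ?thesis
  proof cases
    case 1
    then show ?thesis using R2_lift_ordered[OF gauss ab(1) _ ab(3,4)] D' by simp
  next
    case 2
    have "adjacent D (Head b) (Head a)" "arrow_sign D b = - arrow_sign D a"
      using ab by (auto simp: adjacent_def)
    then show ?thesis
      using R2_lift_ordered[OF gauss _ 2] ab(1) D' by (simp add: insert_commute)
  qed
qed

section \<open>Third Reidemeister move\<close>

text \<open>With the three edges of the triangle empty, the given arrows admit the same third move
  in the realization. Marks keep their places while the ends trade theirs, so the slots at
  \<open>p\<close> inherit the marks formerly at \<open>\<sigma> p\<close>.\<close>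

lemma R3_zero_gaps:
  fixes D :: "nat gauss"
  assumes gauss: "gauss_diagram D" "gauss_diagram D'" and xyz: "distinct [x, y, z]"
    and adj: "adjacent_in_order D \<alpha> (Foot x) (Foot y)"
        "adjacent_in_order D \<beta> (Head x) (Foot z)"
        "adjacent_in_order D \<gamma> (Head y) (Head z)"
    and sgn: "\<alpha> * arrow_sign D y = \<beta> * arrow_sign D z" "\<gamma> * arrow_sign D y = \<beta> * arrow_sign D x"
  defines "\<sigma> \<equiv> Transposition.transpose (Foot x) (Foot y) \<circ>
                Transposition.transpose (Head x) (Foot z) \<circ>
                Transposition.transpose (Head y) (Head z)"
  assumes D': "D' = move_points \<sigma> D"
    and m: "\<And>t. t \<in> gap \<alpha> (Foot x) (Foot y) \<union> gap \<beta> (Head x) (Foot z) \<union> gap \<gamma> (Head y) (Head z) \<Longrightarrow> m t = 0"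
  shows "marked_equiv D m D' (\<lambda>(p, b). m (\<sigma> p, b))"
proof -
  note \<sigma> = triple_transpose[OF xyz, folded \<sigma>_def]
  let ?M = "\<lambda>t. marks (m t)"
  obtain Z where "realizes Z D ?M"
    using realization_exists[of D ?M] set_marks by blast
  then obtain w P where R: "realizes_via w P Z D ?M" by (auto simp: realizes_def)
  have cs: "circles Z = w # map (\<lambda>c. concat (map (block P) c)) (circles D)"
    and G: "labels D P \<inter> range Given = {}" and w: "set w = Foot ` labels D P"
    and sG: "\<And>a. a \<in> arrows D \<Longrightarrow> arrow_sign Z (Given a) = arrow_sign D a"
    using R by (simp_all add: realizes_via_def)
  have xyz_pts: "{Foot x, Foot y, Head x, Foot z, Head y, Head z} \<subseteq> points D"
    using adj adjacent_points(1) by blast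
  have \<sigma>_pts: "\<sigma> p \<in> points D \<longleftrightarrow> p \<in> points D" for p
    using xyz_pts \<sigma>(1-6) \<sigma>(7)[of p]
    by (cases "p \<in> {Foot x, Foot y, Head x, Foot z, Head y, Head z}") auto
  have pts: "points D' = points D"
  proof -
    have "points D' = \<sigma> ` points D" by (auto simp: D' move_points_def points_def)
    then show ?thesis using \<sigma>_pts \<sigma>(8) by (metis (no_types, lifting) image_eqI image_subsetI subsetI subset_antisym)
  qed
  then have slots: "slots D' = slots D" and arrows: "arrows D' = arrows D"
    by (simp_all add: slots_def arrows_def)

  let ?\<tau> = "Transposition.transpose (Foot (Given x)) (Foot (Given y)) \<circ>
                Transposition.transpose (Head (Given x)) (Foot (Given z)) \<circ>
                Transposition.transpose (Head (Given y)) (Head (Given z))"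
  have xyz': "distinct [Given x, Given y, Given z]" using xyz by simp
  note \<tau> = triple_transpose[OF xyz']
  have \<tau>_given: "?\<tau> (map_endpoint Given p) = map_endpoint Given (\<sigma> p)" for p
  proof (cases "p \<in> {Foot x, Foot y, Head x, Foot z, Head y, Head z}")
    case True
    then show ?thesis using \<sigma>(1-6) \<tau>(1-6) by auto
  next
    case False
    moreover from False have "?\<tau> (map_endpoint Given p) = map_endpoint Given p"
      by (intro \<tau>(7)) (cases p; auto)
    ultimately show ?thesis using \<sigma>(7) by simp
  qed
  have \<tau>_label: "?\<tau> (Head l) = Head l" "?\<tau> (Foot l) = Foot l" if "l \<in> labels D P" for l
  proof -
    have "l \<noteq> Given a" for a using that G by auto
    then show "?\<tau> (Head l) = Head l" "?\<tau> (Foot l) = Foot l" by (intro \<tau>(7); simp)+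
  qed
  define Z' where "Z' = move_points ?\<tau> Z"
  define P' where "P' = (\<lambda>(p, b). P (\<sigma> p, b))"
  have block: "map ?\<tau> (block P p) = block P' (\<sigma> p)" if p: "p \<in> points D" for p
  proof -
    have "map ?\<tau> (map Head (P (p, b))) = map Head (P (p, b))" for b
      unfolding map_map
    proof (intro map_cong refl)
      fix l assume "l \<in> set (P (p, b))"
      then have "l \<in> labels D P" using p unfolding labels_def by (metis UN_I in_slots)
      then show "(?\<tau> \<circ> Head) l = Head l" using \<tau>_label by simp
    qed
    then show ?thesis using \<tau>_given by (simp add: block_def P'_def \<sigma>(8) del: o_apply map_map)
  qed
  have R': "realizes_via w P' Z' D' (\<lambda>(p, b). marks (m (\<sigma> p, b)))"
    unfolding realizes_via_def slots arrows
  proof (intro conjI ballI impI)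
    have "map ?\<tau> w = w" using w \<tau>_label by (intro map_idI) auto
    moreover have "map ?\<tau> (concat (map (block P) c)) = concat (map (block P') (map \<sigma> c))"
      if "c \<in> set (circles D)" for c
    proof -
      have "map ?\<tau> (block P p) = block P' (\<sigma> p)" if "p \<in> set c" for p
        using that \<open>c \<in> set (circles D)\<close> by (intro block) (auto simp: points_def)
      then have "map (\<lambda>p. map ?\<tau> (block P p)) c = map (\<lambda>p. block P' (\<sigma> p)) c"
        by (intro map_cong refl)
      then show ?thesis
        unfolding map_concat map_map comp_def[of "map ?\<tau>"] comp_def[of "block P'"] by (rule arg_cong)
    qed
    then have "map (map ?\<tau>) (map (\<lambda>c. concat (map (block P) c)) (circles D)) =
        map (\<lambda>c. concat (map (block P') c)) (map (map \<sigma>) (circles D))"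
      unfolding map_map[of "map ?\<tau>"] map_map[of _ "map \<sigma>"] comp_def[of "map ?\<tau>"] comp_def[of _ "map \<sigma>"]
      by (intro map_cong refl)
    ultimately show "circles Z' = w # map (\<lambda>c. concat (map (block P') c)) (circles D')"
      by (simp add: Z'_def D' move_points_def cs del: map_map)
    show "arrow_sign Z' (Given a) = arrow_sign D' a" if "a \<in> arrows D" for a
      using sG that by (simp add: Z'_def D' move_points_def)
    have labs: "labels D' P' = labels D P"
    proof -
      have "(\<lambda>(p, b). (\<sigma> p, b)) ` slots D = slots D"
      proof (intro equalityI subsetI)
        fix t assume "t \<in> slots D"
        then have "(\<sigma> (fst t), snd t) \<in> slots D" "t = (\<lambda>(p, b). (\<sigma> p, b)) (\<sigma> (fst t), snd t)"
          using \<sigma>_pts by (simp_all add: \<sigma>(8) slots_def mem_Times_iff)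
        then show "t \<in> (\<lambda>(p, b). (\<sigma> p, b)) ` slots D" by (rule rev_image_eqI)
      qed (auto simp: \<sigma>_pts)
      then have "labels D P = (\<Union>t\<in>(\<lambda>(p, b). (\<sigma> p, b)) ` slots D. set (P t))" by (simp add: labels_def)
      also have "\<dots> = labels D' P'"
        unfolding labels_def slots P'_def by (simp add: case_prod_beta')
      finally show ?thesis ..
    qed
    show "distinct w" using R by (simp add: realizes_via_def)
    show "set w = Foot ` labels D' P'" "labels D' P' \<inter> range Given = {}" using w G labs by simp_all
    fix t assume "t \<in> slots D"
    moreover obtain p b where pb: "t = (p, b)" by (cases t)
    ultimately have t: "(\<sigma> p, b) \<in> slots D" using \<sigma>_pts by simp
    have sZ: "arrow_sign Z' = arrow_sign Z" by (simp add: Z'_def move_points_def)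
    show "distinct (P' t)" "map (arrow_sign Z') (P' t) = (case t of (p, b) \<Rightarrow> marks (m (\<sigma> p, b)))"
      "set (case t of (p, b) \<Rightarrow> marks (m (\<sigma> p, b))) \<subseteq> {1, -1}"
      using R t set_marks by (simp_all add: pb P'_def sZ realizes_via_def)
    show "set (P' t) \<inter> set (P' t') = {}" if "t' \<in> slots D" "t \<noteq> t'" for t'
    proof -
      obtain q c where qc: "t' = (q, c)" by (cases t')
      have "(\<sigma> q, c) \<in> slots D" "(\<sigma> p, b) \<noteq> (\<sigma> q, c)"
        using that \<sigma>_pts pb qc inj_eq[OF inj_on_inverseI[of UNIV \<sigma> \<sigma>, OF \<sigma>(8)]] by auto
      then show ?thesis using R t by (simp add: pb qc P'_def realizes_via_def)
    qed
  qed
  have next_Z: "adjacent_in_order Z \<delta> (map_endpoint Given p) (map_endpoint Given q)"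
    if adj: "adjacent_in_order D \<delta> p q" "p \<noteq> q" and g: "\<And>t. t \<in> gap \<delta> p q \<Longrightarrow> m t = 0" for \<delta> p q
  proof -
    have empty: "P t = []" if "t \<in> gap \<delta> p q" for t
      using empty_labels[OF R, of t] g[OF that] that adjacent_points(1)[OF adj(1)]
      by (auto simp: gap_def split: if_splits)
    show ?thesis
      using adj next_to_realization[OF R, of p q] next_to_realization[OF R, of q p] empty
      by (auto simp: adjacent_in_order_def gap_def)
  qed
  have "adjacent_in_order Z \<alpha> (Foot (Given x)) (Foot (Given y))"
    "adjacent_in_order Z \<beta> (Head (Given x)) (Foot (Given z))"
    "adjacent_in_order Z \<gamma> (Head (Given y)) (Head (Given z))"
    using next_Z[OF adj(1)] next_Z[OF adj(2)] next_Z[OF adj(3)] xyz m by simp_all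
  moreover have "x \<in> arrows D" "y \<in> arrows D" "z \<in> arrows D"
    using xyz_pts arrow_in_arrows[OF gauss(1)] by auto
  then have "\<alpha> * arrow_sign Z (Given y) = \<beta> * arrow_sign Z (Given z)"
      "\<gamma> * arrow_sign Z (Given y) = \<beta> * arrow_sign Z (Given x)"
    using sgn sG by simp_all
  ultimately have "R3_move Z Z'"
    unfolding R3_move_def Z'_def using xyz' by blast
  then have "semiwelded_move Z Z'" by (simp add: semiwelded_move_def reidemeister_move_def)
  then have "Z \<approx> Z'"
    using realizes_semiwelded[OF R gauss(1)] realizes_semiwelded[OF R' gauss(2)]
    by (intro semiwelded_equiv_step)
  moreover have "(\<lambda>t. marks ((\<lambda>(p, b). m (\<sigma> p, b)) t)) = (\<lambda>(p, b). marks (m (\<sigma> p, b)))" by auto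
  ultimately show ?thesis
    using decorated_equivI[OF gauss, of Z ?M Z'] R R' unfolding realizes_def by metis
qed

text \<open>The multiplicities in \<open>m\<close> and \<open>n\<close> below solve the linear system stating that the pushes clear
  the three edges of the triangle before and after the move; the solution for \<open>m\<close> is normalised to be
  \<open>0\<close> at \<open>y\<close>, and \<open>n\<close> has to agree with \<open>m\<close> outside the triangle. The system is solvable because of the
  sign conditions of the move.\<close>

lemma R3_lift:
  fixes D :: "nat gauss"
  assumes gauss: "gauss_diagram D" "gauss_diagram D'" and R3: "R3_move D D'"
  shows "marked_equiv D (zh_marks D) D' (zh_marks D')"
proof -
  obtain x y z \<alpha> \<beta> \<gamma> where xyz: "distinct [x, y, z]"
    and adj: "adjacent_in_order D \<alpha> (Foot x) (Foot y)"
        "adjacent_in_order D \<beta> (Head x) (Foot z)"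
        "adjacent_in_order D \<gamma> (Head y) (Head z)"
    and sgn: "\<alpha> * arrow_sign D y = \<beta> * arrow_sign D z" "\<gamma> * arrow_sign D y = \<beta> * arrow_sign D x"
    and D': "D' = move_points
               (Transposition.transpose (Foot x) (Foot y) \<circ>
                Transposition.transpose (Head x) (Foot z) \<circ>
                Transposition.transpose (Head y) (Head z)) D"
    using R3 unfolding R3_move_def by blast
  define \<sigma> where "\<sigma> = Transposition.transpose (Foot x) (Foot y) \<circ>
                Transposition.transpose (Head x) (Foot z) \<circ>
                Transposition.transpose (Head y) (Head z)"
  note \<sigma> = triple_transpose[OF xyz, folded \<sigma>_def]
  have c: "circles D' = map (map \<sigma>) (circles D)" and sD': "arrow_sign D' = arrow_sign D"
    by (simp_all add: D' \<sigma>_def move_points_def)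
  have adj': "adjacent_in_order D' (- \<alpha>) (Foot x) (Foot y)"
        "adjacent_in_order D' (- \<beta>) (Head x) (Foot z)"
        "adjacent_in_order D' (- \<gamma>) (Head y) (Head z)"
    using adjacent_in_order_map_circles[OF adj(1) c] adjacent_in_order_map_circles[OF adj(2) c]
      adjacent_in_order_map_circles[OF adj(3) c] unfolding \<sigma>(1-6) .
  have xD: "x \<in> arrows D" "y \<in> arrows D" "z \<in> arrows D"
    using adjacent_points(1)[OF adj(1)] adjacent_points(1)[OF adj(3)] arrow_in_arrows[OF gauss(1)] by auto
  have xD': "x \<in> arrows D'" "y \<in> arrows D'" "z \<in> arrows D'"
    using adjacent_points(1)[OF adj'(1)] adjacent_points(1)[OF adj'(3)] arrow_in_arrows[OF gauss(2)] by auto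
  let ?ex = "arrow_sign D x" and ?ey = "arrow_sign D y" and ?ez = "arrow_sign D z"
  have e: "?ex = 1 \<or> ?ex = -1" "?ey = 1 \<or> ?ey = -1" "?ez = 1 \<or> ?ez = -1"
    using gauss(1) xD by (auto simp: gauss_diagram_def)
  have greek: "\<alpha> = 1 \<or> \<alpha> = -1" "\<beta> = 1 \<or> \<beta> = -1" "\<gamma> = 1 \<or> \<gamma> = -1"
    using adj by (auto simp: adjacent_in_order_def)
  let ?top = "\<lambda>\<delta>. gap \<delta> (Foot x) (Foot y)" and ?mid = "\<lambda>\<delta>. gap \<delta> (Head x) (Foot z)"
    and ?bot = "\<lambda>\<delta>. gap \<delta> (Head y) (Head z)"
  define m where "m = push x (if \<alpha> = 1 then ?ey else - ?ex)
    (push z (if \<gamma> = 1 then ?ey else - ?ez) (zh_marks D))"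
  define n where "n = push x (if \<alpha> = 1 then 0 else ?ey - ?ex)
    (push y (\<alpha> * ?ex) (push z (if \<gamma> = 1 then 0 else ?ey - ?ez) (zh_marks D')))"
  define m0 where "m0 = clear (?bot \<gamma>) (clear (?mid \<beta>) (clear (?top \<alpha>) m))"
  define n0 where "n0 = clear (?bot (-\<gamma>)) (clear (?mid (-\<beta>)) (clear (?top (-\<alpha>)) n))"
  have zh: "zh_marks D (Foot a, False) = - arrow_sign D a" "zh_marks D (Foot a, True) = 0"
    "zh_marks D (Head a, False) = 0" "zh_marks D (Head a, True) = arrow_sign D a"
    "zh_marks D' (Foot a, False) = - arrow_sign D a" "zh_marks D' (Foot a, True) = 0"
    "zh_marks D' (Head a, False) = 0" "zh_marks D' (Head a, True) = arrow_sign D a" for a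
    by (simp_all add: zh_marks_def sD')
  have m_vals: "m (p, b) = zh_marks D (p, b) +
      (if b then 1 else -1) * (if arrow_of p = x then (if \<alpha> = 1 then ?ey else - ?ex)
      else if arrow_of p = z then (if \<gamma> = 1 then ?ey else - ?ez) else 0)" for p b
    using xyz by (simp add: m_def push_def)
  have n_vals: "n (p, b) = zh_marks D' (p, b) +
      (if b then 1 else -1) * (if arrow_of p = x then (if \<alpha> = 1 then 0 else ?ey - ?ex)
      else if arrow_of p = y then \<alpha> * ?ex
      else if arrow_of p = z then (if \<gamma> = 1 then 0 else ?ey - ?ez) else 0)" for p b
    using xyz by (auto simp add: n_def push_def)
  have zh_D': "zh_marks D' = zh_marks D" unfolding zh_marks_def sD' by (rule refl)
  have ne: "x \<noteq> y" "x \<noteq> z" "y \<noteq> z" "y \<noteq> x" "z \<noteq> x" "z \<noteq> y" using xyz by auto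
  \<comment> \<open>The sign conditions, solved for the signs of \<open>x\<close> and
    \<open>z\<close>; every case below reduces to the sign of \<open>y\<close>.\<close>
  have ex: "?ex = \<beta> * \<gamma> * ?ey" and ez: "?ez = \<alpha> * \<beta> * ?ey"
    using greek(2) sgn by (elim disjE; simp)+
  have m0_vals: "m0 (Foot x, b) = (if (\<alpha> = 1) = b then 0 else m (Foot x, b))"
    "m0 (Foot y, b) = (if (\<alpha> = 1) = b then m (Foot y, b) else 0)"
    "m0 (Head x, b) = (if (\<beta> = 1) = b then 0 else m (Head x, b))"
    "m0 (Foot z, b) = (if (\<beta> = 1) = b then m (Foot z, b) else 0)"
    "m0 (Head y, b) = (if (\<gamma> = 1) = b then 0 else m (Head y, b))"
    "m0 (Head z, b) = (if (\<gamma> = 1) = b then m (Head z, b) else 0)" for b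
    by (cases b; simp add: m0_def clear_def gap_def ne)+
  have n0_vals: "n0 (Foot x, b) = (if (- \<alpha> = 1) = b then 0 else n (Foot x, b))"
    "n0 (Foot y, b) = (if (- \<alpha> = 1) = b then n (Foot y, b) else 0)"
    "n0 (Head x, b) = (if (- \<beta> = 1) = b then 0 else n (Head x, b))"
    "n0 (Foot z, b) = (if (- \<beta> = 1) = b then n (Foot z, b) else 0)"
    "n0 (Head y, b) = (if (- \<gamma> = 1) = b then 0 else n (Head y, b))"
    "n0 (Head z, b) = (if (- \<gamma> = 1) = b then n (Head z, b) else 0)" for b
    by (cases b; simp add: n0_def clear_def gap_def ne)+
  \<comment> \<open>Given the value at \<open>y\<close>, the top edge determines the multiplicity at
    \<open>x\<close> and the bottom edge the one at \<open>z\<close>. The middle edge is the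
    remaining equation, and it is satisfied because of \<open>ex\<close> and
    \<open>ez\<close>.\<close>
  have sums: "sum m (?top \<alpha>) = 0" "sum (clear (?top \<alpha>) m) (?mid \<beta>) = 0"
      "sum (clear (?mid \<beta>) (clear (?top \<alpha>) m)) (?bot \<gamma>) = 0"
    using greek by (elim disjE; simp add: gap_def clear_def m_vals zh ne ex ez)+
  have sums': "sum n (?top (-\<alpha>)) = 0" "sum (clear (?top (-\<alpha>)) n) (?mid (-\<beta>)) = 0"
      "sum (clear (?mid (-\<beta>)) (clear (?top (-\<alpha>)) n)) (?bot (-\<gamma>)) = 0"
    using greek by (elim disjE; simp add: gap_def clear_def n_vals zh ne ex ez)+
  have "marked_equiv D (zh_marks D) D m"
    unfolding m_def using push_equiv[OF gauss(1)] xD by (blast intro: marked_equiv_trans)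
  also have "marked_equiv D m D (clear (?top \<alpha>) m)"
    using xyz by (intro clear_gap_equiv[OF gauss(1) adj(1) _ sums(1)]) simp
  also have "marked_equiv D (clear (?top \<alpha>) m) D (clear (?mid \<beta>) (clear (?top \<alpha>) m))"
    by (intro clear_gap_equiv[OF gauss(1) adj(2) _ sums(2)]) simp
  also have "marked_equiv D (clear (?mid \<beta>) (clear (?top \<alpha>) m)) D m0"
    unfolding m0_def using xyz by (intro clear_gap_equiv[OF gauss(1) adj(3) _ sums(3)]) simp
  also have "marked_equiv D m0 D' (\<lambda>(p, b). m0 (\<sigma> p, b))"
    unfolding \<sigma>_def by (rule R3_zero_gaps[OF gauss xyz adj sgn D']) (auto simp: m0_def clear_def)
  \<comment> \<open>At each of the six ends only the slot outside the triangle can still carry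
    marks, and there \<open>n\<close> was chosen to match \<open>m\<close>. All other ends belong to
    unpushed arrows, where both sides are \<open>zh_marks D\<close>.\<close>
  also have "(\<lambda>(p, b). m0 (\<sigma> p, b)) = n0"
  proof (intro ext, clarify)
    fix p b
    show "m0 (\<sigma> p, b) = n0 (p, b)"
    proof (cases "p \<in> {Foot x, Foot y, Head x, Foot z, Head y, Head z}")
      case True
      have "m0 (Foot y, b) = n0 (Foot x, b)" "m0 (Foot x, b) = n0 (Foot y, b)"
        "m0 (Foot z, b) = n0 (Head x, b)" "m0 (Head x, b) = n0 (Foot z, b)"
        "m0 (Head z, b) = n0 (Head y, b)" "m0 (Head y, b) = n0 (Head z, b)"
        unfolding m0_vals n0_vals m_vals n_vals using greek
        by (elim disjE; simp add: ne zh ex ez)+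
      then show ?thesis using True by (auto simp: \<sigma>(1-6))
    next
      case False
      then have "m0 (p, b) = m (p, b)" "n0 (p, b) = n (p, b)"
        by (auto simp: m0_def n0_def clear_def gap_def)
      moreover have "arrow_of p \<notin> {x, y, z}" using False by (cases p) auto
      ultimately show ?thesis
        using \<sigma>(7)[OF False] by (simp add: m_vals n_vals zh_D')
    qed
  qed
  also have "marked_equiv D' n0 D' (zh_marks D')"
  proof (rule decorated_equiv_sym)
    have "marked_equiv D' (zh_marks D') D' n"
      unfolding n_def using push_equiv[OF gauss(2)] xD' by (blast intro: marked_equiv_trans)
    also have "marked_equiv D' n D' (clear (?top (-\<alpha>)) n)"
      using xyz by (intro clear_gap_equiv[OF gauss(2) adj'(1) _ sums'(1)]) simp
    also have "marked_equiv D' (clear (?top (-\<alpha>)) n) D' (clear (?mid (-\<beta>)) (clear (?top (-\<alpha>)) n))"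
      by (intro clear_gap_equiv[OF gauss(2) adj'(2) _ sums'(2)]) simp
    also have "marked_equiv D' (clear (?mid (-\<beta>)) (clear (?top (-\<alpha>)) n)) D' n0"
      unfolding n0_def using xyz by (intro clear_gap_equiv[OF gauss(2) adj'(3) _ sums'(3)]) simp
    finally show "marked_equiv D' (zh_marks D') D' n0" .
  qed
  finally show ?thesis .
qed


section \<open>Functoriality\<close>

lemma Zh_cases:
  assumes "Z \<in> Zh D"
  obtains w where "Z = zh_with w D" "distinct w"
    "set w = Foot ` (AtFoot ` arrows D \<union> AtHead ` arrows D)"
  using assms unfolding Zh_def by blast

text \<open>Signs are 1 or -1, so each nonempty slot carries the single mark prescribed by the
  construction.\<close>

lemma Zh_realizes:
  fixes D :: "'a gauss"
  assumes gauss: "gauss_diagram D" and Z: "Z \<in> Zh D"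
  shows "realizes Z D (\<lambda>t. marks (zh_marks D t))"
proof -
  obtain w where w: "Z = zh_with w D" "distinct w"
    "set w = Foot ` (AtFoot ` arrows D \<union> AtHead ` arrows D)"
    using Zh_cases[OF Z] .
  define P :: "'a slot \<Rightarrow> 'a zh_arrow list" where "P = (\<lambda>(p, b). case p of
    Foot a \<Rightarrow> if b then [] else [AtFoot a] | Head a \<Rightarrow> if b then [AtHead a] else [])"
  have blk: "block P p = zh_endpoint p" for p :: "'a endpoint"
    by (cases p) (simp_all add: block_def P_def)
  have fun_blk: "block P = (zh_endpoint :: 'a endpoint \<Rightarrow> _)" using blk by blast
  have labs: "labels D P = AtFoot ` arrows D \<union> AtHead ` arrows D"
  proof (intro equalityI subsetI)
    fix l assume "l \<in> labels D P"
    then obtain p b where p: "p \<in> points D" "l \<in> set (P (p, b))"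
      by (auto simp: labels_def slots_def)
    then have "arrow_of p \<in> arrows D" by (simp add: arrows_def)
    then show "l \<in> AtFoot ` arrows D \<union> AtHead ` arrows D"
      using p(2) by (cases p; cases b) (auto simp: P_def)
  next
    fix l assume "l \<in> AtFoot ` arrows D \<union> AtHead ` arrows D"
    then obtain a where a: "a \<in> arrows D" and "l = AtFoot a \<or> l = AtHead a" by auto
    then have "l \<in> set (P (Foot a, False)) \<or> l \<in> set (P (Head a, True))" by (auto simp: P_def)
    moreover have "(Foot a, False) \<in> slots D" "(Head a, True) \<in> slots D"
      using a arrow_in_arrows[OF gauss] by auto
    ultimately show "l \<in> labels D P" unfolding labels_def by blast
  qed
  have sgn: "arrow_sign D a = 1 \<or> arrow_sign D a = -1" if "a \<in> arrows D" for a
    using gauss that by (auto simp: gauss_diagram_def)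
  have "realizes_via w P Z D (\<lambda>t. marks (zh_marks D t))"
    unfolding realizes_via_def
  proof (intro conjI ballI impI)
    show "circles Z = w # map (\<lambda>c. concat (map (block P) c)) (circles D)"
      by (simp add: w(1) zh_with_def fun_blk)
    show "arrow_sign Z (Given a) = arrow_sign D a" for a by (simp add: w(1) zh_with_def)
    show "distinct w" "set w = Foot ` labels D P" using w labs by simp_all
    show "labels D P \<inter> range Given = {}" using labs by auto
    fix t assume t: "t \<in> slots D"
    show "set (marks (zh_marks D t)) \<subseteq> {1, -1}" by (rule set_marks)
    obtain p b where pb: "t = (p, b)" by (cases t)
    have "arrow_of p \<in> arrows D" using t pb by (simp add: arrows_def)
    then show "distinct (P t)" "map (arrow_sign Z) (P t) = marks (zh_marks D t)"
      using sgn[of "arrow_of p"]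
      by (cases p; auto simp: pb P_def zh_marks_def w(1) zh_with_def)+
    show "set (P t) \<inter> set (P t') = {}" if "t \<noteq> t'" for t'
    proof -
      obtain q c where "t' = (q, c)" by (cases t')
      then show ?thesis using that pb by (cases p; cases q) (auto simp: P_def)
    qed
  qed
  then show ?thesis by (auto simp: realizes_def)
qed

lemma Zh_lift:
  assumes "gauss_diagram D" "gauss_diagram D'" "marked_equiv D (zh_marks D) D' (zh_marks D')"
    and "Z \<in> Zh D" "Z' \<in> Zh D'"
  shows "Z \<approx> Z'"
  using assms Zh_realizes unfolding decorated_equiv_def by blast

lemma Zh_equiv:
  assumes "gauss_diagram D" "Z \<in> Zh D" "Z' \<in> Zh D"
  shows "Z \<approx> Z'"
  using Zh_lift[OF assms(1,1) decorated_equiv_refl[OF assms(1)] assms(2,3)] .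

text \<open>The relabelling of \<open>D\<close> acts on the labels of \<open>Zh\<close> and, on
  \<omega>, determines one representative of \<open>Zh D'\<close>; all others are equivalent to
  it.\<close>

lemma Zh_same_diagram:
  assumes gauss: "gauss_diagram D" "gauss_diagram D'" and same: "same_diagram_via \<pi> D D'"
    and Z: "Z \<in> Zh D" and Z': "Z' \<in> Zh D'"
  shows "Z \<approx> Z'"
proof -
  let ?n = "length (circles D)"
  obtain f where len: "length (circles D') = ?n" and \<pi>: "\<pi> permutes {..<?n}"
    and f: "inj_on f (arrows D)" "\<forall>a\<in>arrows D. arrow_sign D' (f a) = arrow_sign D a"
    and c: "\<And>i. i < ?n \<Longrightarrow> \<exists>k. circles D' ! \<pi> i = rotate k (map (map_endpoint f) (circles D ! i))"
    using same unfolding same_diagram_via_def by blast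
  have arr: "arrows D' = f ` arrows D" using same_diagram_arrows[OF len \<pi> c] .
  obtain w where w: "Z = zh_with w D" "distinct w"
    "set w = Foot ` (AtFoot ` arrows D \<union> AtHead ` arrows D)"
    using Zh_cases[OF Z] .
  define F where "F = map_zh_arrow f"
  define w' where "w' = map (map_endpoint F) w"
  define Z1 where "Z1 = zh_with w' D'"
  have setw: "set w' = Foot ` (AtFoot ` arrows D' \<union> AtHead ` arrows D')"
    by (simp add: w'_def w(3) arr F_def image_image image_Un)
  have injF: "inj_on F (Given ` arrows D \<union> AtFoot ` arrows D \<union> AtHead ` arrows D)"
    by (rule inj_onI) (auto simp: F_def dest: inj_onD[OF f(1)])
  have "inj_on (map_endpoint F) (set w)"
    unfolding w(3) by (rule inj_onI) (auto simp: F_def dest: inj_onD[OF f(1)])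
  then have "distinct w'" using w(2) by (simp add: w'_def distinct_map)
  then have Z1: "Z1 \<in> Zh D'" using setw unfolding Zh_def Z1_def by blast

  have arrows_Z: "l \<in> Given ` arrows D \<union> AtFoot ` arrows D \<union> AtHead ` arrows D" if "l \<in> arrows Z" for l
  proof -
    obtain p where p: "p \<in> points Z" "l = arrow_of p" using \<open>l \<in> arrows Z\<close> by (auto simp: arrows_def)
    then consider "p \<in> set w" | q where "q \<in> points D" "p \<in> set (zh_endpoint q)"
      by (auto simp: points_def w(1) zh_with_def)
    then show ?thesis
    proof cases
      case 1
      then show ?thesis using p(2) w(3) by auto
    next
      case 2
      then have "arrow_of q \<in> arrows D" by (simp add: arrows_def)
      then show ?thesis using 2(2) p(2) by (cases q) auto
    qed
  qed
  \<comment> \<open>The numbering is shifted by one since \<omega> occupies number 0, which must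
    stay fixed.\<close>
  define \<rho> where "\<rho> i = (case i of 0 \<Rightarrow> 0 | Suc j \<Rightarrow> Suc (\<pi> j))" for i
  have "\<rho> permutes {..<Suc ?n}"
  proof (rule bij_imp_permutes)
    have "\<rho> ` {..<Suc ?n} = insert 0 (Suc ` \<pi> ` {..<?n})"
      by (auto simp: lessThan_Suc_eq_insert_0 \<rho>_def image_image)
    also have "\<dots> = {..<Suc ?n}" using permutes_image[OF \<pi>] by (simp add: lessThan_Suc_eq_insert_0)
    finally have "\<rho> ` {..<Suc ?n} = {..<Suc ?n}" .
    moreover have "inj \<rho>"
      by (rule injI) (auto simp: \<rho>_def inj_eq[OF permutes_inj[OF \<pi>]] split: nat.splits)
    ultimately show "bij_betw \<rho> {..<Suc ?n} {..<Suc ?n}"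
      by (auto simp: bij_betw_def intro: inj_on_subset)
    show "\<rho> i = i" if "i \<notin> {..<Suc ?n}" for i
      using that permutes_not_in[OF \<pi>] by (cases i) (auto simp: \<rho>_def)
  qed
  moreover have "length (circles Z) = Suc ?n" "length (circles Z1) = length (circles Z)"
    by (simp_all add: w(1) Z1_def zh_with_def len)
  moreover have "inj_on F (arrows Z)"
    using injF arrows_Z by (meson inj_on_subset subsetI)
  moreover have "arrow_sign Z1 (F l) = arrow_sign Z l" if "l \<in> arrows Z" for l
    using arrows_Z[OF that] f(2) by (auto simp: F_def w(1) Z1_def zh_with_def)
  moreover have "\<exists>k. circles Z1 ! \<rho> i = rotate k (map (map_endpoint F) (circles Z ! i))"
    if i: "i < length (circles Z)" for i
  proof (cases i)
    case 0
    then show ?thesis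
      by (intro exI[of _ 0]) (simp add: \<rho>_def Z1_def w(1) zh_with_def w'_def)
  next
    case (Suc j)
    then have j: "j < ?n" using i by (simp add: w(1) zh_with_def)
    obtain k where k: "circles D' ! \<pi> j = rotate k (map (map_endpoint f) (circles D ! j))"
      using c[OF j] by blast
    have z: "zh_endpoint (map_endpoint f p) = map (map_endpoint F) (zh_endpoint p)" for p
      by (cases p) (simp_all add: F_def)
    have "concat (map zh_endpoint (map (map_endpoint f) xs)) =
        map (map_endpoint F) (concat (map zh_endpoint xs))" for xs
      by (induction xs) (simp_all add: z)
    moreover obtain k' where "concat (map zh_endpoint (rotate k (map (map_endpoint f) (circles D ! j)))) =
        rotate k' (concat (map zh_endpoint (map (map_endpoint f) (circles D ! j))))"
      using rotate_concat_map by blast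
    ultimately have "concat (map zh_endpoint (circles D' ! \<pi> j)) =
        rotate k' (map (map_endpoint F) (concat (map zh_endpoint (circles D ! j))))"
      by (simp only: k)
    moreover have "\<pi> j < ?n" using permutes_in_image[OF \<pi>] j by simp
    ultimately show ?thesis
      using j by (intro exI[of _ k']) (simp add: Suc \<rho>_def Z1_def w(1) zh_with_def len)
  qed
  ultimately have "same_diagram_via \<rho> Z Z1" unfolding same_diagram_via_def by auto
  moreover have "\<rho> 0 = 0" by (simp add: \<rho>_def)
  ultimately have "semiwelded_move Z Z1" unfolding semiwelded_move_def by blast
  then have "Z \<approx> Z1"
    by (intro semiwelded_equiv_step Zh_semiwelded_diagram[OF gauss(1) Z] Zh_semiwelded_diagram[OF gauss(2) Z1])
  also have "Z1 \<approx> Z'" using Zh_equiv[OF gauss(2) Z1 Z'] .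
  finally show ?thesis .
qed

lemma Zh_virtual_move:
  fixes D D' :: "nat gauss"
  assumes gauss: "gauss_diagram D" "gauss_diagram D'" and move: "virtual_move D D'"
    and Z: "Z \<in> Zh D" "Z' \<in> Zh D'"
  shows "Z \<approx> Z'"
proof -
  consider \<pi> where "same_diagram_via \<pi> D D'" | "R1_removal D D'" | "R1_removal D' D"
    | "R2_removal D D'" | "R2_removal D' D" | "R3_move D D'"
    using move by (auto simp: virtual_move_def reidemeister_move_def)
  then show ?thesis
  proof cases
    case 1
    then show ?thesis using Zh_same_diagram[OF gauss _ Z] by blast
  next
    case 2
    then show ?thesis using Zh_lift[OF gauss R1_lift[OF gauss(1)] Z] by blast
  next
    case 3
    then show ?thesis using Zh_lift[OF gauss decorated_equiv_sym[OF R1_lift[OF gauss(2)]] Z] by blast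
  next
    case 4
    then show ?thesis using Zh_lift[OF gauss R2_lift[OF gauss(1)] Z] by blast
  next
    case 5
    then show ?thesis using Zh_lift[OF gauss decorated_equiv_sym[OF R2_lift[OF gauss(2)]] Z] by blast
  next
    case 6
    then show ?thesis using Zh_lift[OF gauss R3_lift[OF gauss] Z] by blast
  qed
qed

section \<open>Births, deaths and saddles\<close>

text \<open>A word on \<omega> is admissible according to the set of arrows only, so it can be kept
  when circles are born, die, split or join.\<close>

lemma zh_with_in_Zh:
  assumes "zh_with w D \<in> Zh D" "arrows E = arrows D"
  shows "zh_with w E \<in> Zh E"
proof -
  obtain v where "zh_with w D = zh_with v D" "distinct v"
    "set v = Foot ` (AtFoot ` arrows D \<union> AtHead ` arrows D)"
    using Zh_cases[OF assms(1)] .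
  then show ?thesis using assms(2) unfolding Zh_def by (auto simp: zh_with_def)
qed

lemma birth_zh_with:
  assumes "birth D D'"
  shows "birth (zh_with w D) (zh_with w D')" "arrows D' = arrows D"
  using assms by (simp_all add: birth_def zh_with_def arrows_def points_def)

text \<open>Replacing ends by words respects concatenation, so the cut of a circle carries over. The
  shifted index is never 0, so the saddle avoids \<omega>.\<close>

lemma saddle_split_zh_with:
  assumes "saddle_split i D D'"
  shows "saddle_split (Suc i) (zh_with w D) (zh_with w D')" "arrows D' = arrows D"
proof -
  obtain u v where i: "i < length (circles D)" "circles D ! i = u @ v"
    and D': "D' = D\<lparr>circles := (circles D)[i := u] @ [v]\<rparr>"
    using assms by (auto simp: saddle_split_def)
  let ?g = "\<lambda>c. concat (map zh_endpoint c)"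
  show "saddle_split (Suc i) (zh_with w D) (zh_with w D')"
    unfolding saddle_split_def
    using i by (auto simp: zh_with_def D' map_update intro!: exI[of _ "?g u"] exI[of _ "?g v"])
  have "circles D = take i (circles D) @ (u @ v) # drop (Suc i) (circles D)"
    using i by (metis id_take_nth_drop)
  then have "points D = set (concat (take i (circles D) @ (u @ v) # drop (Suc i) (circles D)))"
    by (simp add: points_def)
  moreover have "points D' = set (concat (take i (circles D) @ u # drop (Suc i) (circles D) @ [v]))"
    using i(1) by (simp add: points_def D' upd_conv_take_nth_drop)
  ultimately have "points D' = points D" by auto
  then show "arrows D' = arrows D" by (simp add: arrows_def)
qed

text \<open>The claim covers every representative of \<open>Zh D'\<close>: a birth, death or saddle
  ending at a given representative starts from the one with the same word on \<omega>, and the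
  induction hypothesis must reach precisely that one.\<close>

lemma Zh_cobordism_sequence:
  fixes D D' :: "nat gauss"
  assumes "cobordism_sequence gauss_diagram virtual_move virtual_saddle D D' b d s" "Z \<in> Zh D"
  shows "gauss_diagram D' \<and> (\<forall>Z'\<in>Zh D'.
    cobordism_sequence semiwelded_diagram semiwelded_move semiwelded_saddle Z Z' b d s)"
  using assms(1)
proof (induction rule: cobordism_sequence.induct)
  case start
  then have "cobordism_sequence semiwelded_diagram semiwelded_move semiwelded_saddle Z Z 0 0 0"
    using Zh_semiwelded_diagram assms(2) by (intro cobordism_sequence.start)
  then show ?case using start Zh_equiv assms(2) cobordism_sequence_equiv by blast
next
  case (eqv_step E b d s F)
  obtain Y where "Y \<in> Zh E" using Zh_nonempty by blast
  then show ?case using eqv_step Zh_virtual_move cobordism_sequence_equiv by blast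
next
  case (birth_step E b d s F)
  {
    fix Z' assume Z': "Z' \<in> Zh F"
    then obtain w where w: "Z' = zh_with w F" using Zh_cases by blast
    \<comment> \<open>The word of the prescribed end is carried back to the diagram before the
      birth.\<close>
    have "birth (zh_with w E) Z'" "zh_with w E \<in> Zh E"
      using birth_zh_with[OF birth_step.hyps(2)] zh_with_in_Zh[of w F E] Z' w by auto
    then have "cobordism_sequence semiwelded_diagram semiwelded_move semiwelded_saddle Z Z' (Suc b) d s"
      using birth_step.IH Zh_semiwelded_diagram[OF birth_step.hyps(3) Z']
      by (blast intro: cobordism_sequence.birth_step)
  }
  then show ?case using birth_step.hyps by blast
next
  case (death_step E b d s F)
  {
    fix Z' assume Z': "Z' \<in> Zh F"
    then obtain w where w: "Z' = zh_with w F" using Zh_cases by blast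
    have "birth Z' (zh_with w E)" "zh_with w E \<in> Zh E"
      using birth_zh_with[OF death_step.hyps(2)] zh_with_in_Zh[of w F E] Z' w by auto
    then have "cobordism_sequence semiwelded_diagram semiwelded_move semiwelded_saddle Z Z' b (Suc d) s"
      using death_step.IH Zh_semiwelded_diagram[OF death_step.hyps(3) Z']
      by (blast intro: cobordism_sequence.death_step)
  }
  then show ?case using death_step.hyps by blast
next
  case (saddle_step E b d s F)
  then obtain i where i: "saddle_split i E F \<or> saddle_split i F E" by (auto simp: virtual_saddle_def)
  {
    fix Z' assume Z': "Z' \<in> Zh F"
    then obtain w where w: "Z' = zh_with w F" using Zh_cases by blast
    have "saddle_split (Suc i) (zh_with w E) Z' \<or> saddle_split (Suc i) Z' (zh_with w E)"
      "arrows E = arrows F"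
      using i saddle_split_zh_with w by metis+
    then have "semiwelded_saddle (zh_with w E) Z'" "zh_with w E \<in> Zh E"
      using zh_with_in_Zh[of w F E] Z' w unfolding semiwelded_saddle_def by (blast, simp)
    then have "cobordism_sequence semiwelded_diagram semiwelded_move semiwelded_saddle Z Z' b d (Suc s)"
      using saddle_step.IH Zh_semiwelded_diagram[OF saddle_step.hyps(3) Z']
      by (blast intro: cobordism_sequence.saddle_step)
  }
  then show ?case using saddle_step.hyps by blast
qed

theorem proposition4p3:
  fixes D D' :: "nat gauss" and b d s :: nat
  assumes "virtual_cobordism D D' b d s"
  shows "\<forall>Z\<in>Zh D. \<forall>Z'\<in>Zh D'. semiwelded_cobordism Z Z' b d s"
  using assms Zh_cobordism_sequence
  unfolding virtual_cobordism_def semiwelded_cobordism_def by blast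

end
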